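(* For any graph $G$, $\mathrm{egd}(G)\le \mathrm{la}_{\boxtimes}(G)$.
   Context: All graphs are finite and simple. Notation: $[n]=\{1,\dots,n\}$; $X\succeq 0$ means $X$ is a real symmetric positive semidefinite matrix. Extreme Gram dimension: for a graph $G=([n],E)$, $\mathrm{egd}(G)$ is the smallest integer $r\ge 1$ such that for every $w\in\mathbb{R}^E$ the semidefinite program $\max\ \sum_{ij\in E}w_{ij}X_{ij}$ subject to $X_{ii}=1$ $(i\in[n])$, $X\succeq 0$ ($X$ an $n\times n$ symmetric matrix) has an optimal solution of rank at most $r$. Strong product: for graphs $G=(V,E)$, $G'=(V',E')$, $G\boxtimes G'$ has node set $V\times V'$, and distinct nodes $(i,i'),(j,j')$ are adjacent when ($i=j$ or $\{i,j\}\in E$) and ($i'=j'$ or $\{i',j'\}\in E'$). A graph $M$ is a minor of $G$ if it can be obtained from $G$ by a series of edge deletions, edge contractions and node deletions. The strong largeur d'arborescence $\mathrm{la}_{\boxtimes}(G)$ is the smallest integer $k\ge 1$ for which $G$ is a minor of $T\boxtimes K_k$ for some tree $T$. *)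

theory Defs
  imports "HOL-Analysis.Analysis"
begin

record 'a sgraph =
  nodes :: "'a set"
  edges :: "'a set set"

definition simple_graph :: "'a sgraph \<Rightarrow> bool" where
  "simple_graph G \<longleftrightarrow>
     finite (nodes G) \<and> (\<forall>e \<in> edges G. e \<subseteq> nodes G \<and> card e = 2)"

definition adj :: "'a sgraph \<Rightarrow> 'a \<Rightarrow> 'a \<Rightarrow> bool" where
  "adj G i j \<longleftrightarrow> {i, j} \<in> edges G"

definition graph_iso :: "'a sgraph \<Rightarrow> 'b sgraph \<Rightarrow> bool" where
  "graph_iso G H \<longleftrightarrow>
     (\<exists>f. bij_betw f (nodes G) (nodes H) \<and>
          (\<forall>i \<in> nodes G. \<forall>j \<in> nodes G. adj G i j \<longleftrightarrow> adj H (f i) (f j)))"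

definition complete_graph :: "nat \<Rightarrow> nat sgraph" where
  "complete_graph k = \<lparr>nodes = {..<k}, edges = {e. e \<subseteq> {..<k} \<and> card e = 2}\<rparr>"

definition connected_graph :: "'a sgraph \<Rightarrow> bool" where
  "connected_graph G \<longleftrightarrow> nodes G \<noteq> {} \<and> (\<forall>i \<in> nodes G. \<forall>j \<in> nodes G. (adj G)\<^sup>*\<^sup>* i j)"

definition graph_cycle :: "'a sgraph \<Rightarrow> 'a list \<Rightarrow> bool" where
  "graph_cycle G vs \<longleftrightarrow>
     3 \<le> length vs \<and> distinct vs \<and> set vs \<subseteq> nodes G \<and>
     (\<forall>i < length vs. adj G (vs ! i) (vs ! (Suc i mod length vs)))"

definition graph_tree :: "'a sgraph \<Rightarrow> bool" where
  "graph_tree T \<longleftrightarrow> simple_graph T \<and> connected_graph T \<and> (\<nexists>vs. graph_cycle T vs)"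

definition strong_product :: "'a sgraph \<Rightarrow> 'b sgraph \<Rightarrow> ('a \<times> 'b) sgraph"
    (infixl "\<boxtimes>" 70) where
  "G \<boxtimes> H =
     \<lparr>nodes = nodes G \<times> nodes H,
      edges = {{(i, i'), (j, j')} | i i' j j'.
                 {i, j} \<subseteq> nodes G \<and> {i', j'} \<subseteq> nodes H \<and> (i, i') \<noteq> (j, j') \<and>
                 (i = j \<or> adj G i j) \<and> (i' = j' \<or> adj H i' j')}\<rparr>"

definition delete_edge :: "'a set \<Rightarrow> 'a sgraph \<Rightarrow> 'a sgraph" where
  "delete_edge e G = \<lparr>nodes = nodes G, edges = edges G - {e}\<rparr>"

definition delete_node :: "'a \<Rightarrow> 'a sgraph \<Rightarrow> 'a sgraph" where
  "delete_node v G = \<lparr>nodes = nodes G - {v}, edges = {e \<in> edges G. v \<notin> e}\<rparr>"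

text \<open>Contraction of the edge \<open>{u, v}\<close>: the node \<open>v\<close> is identified with \<open>u\<close>. Parallel edges
  merge because edges are sets, and the cardinality condition drops the loop at \<open>u\<close>.\<close>

definition contract_edge :: "'a \<Rightarrow> 'a \<Rightarrow> 'a sgraph \<Rightarrow> 'a sgraph" where
  "contract_edge u v G =
     (let f = (\<lambda>x. if x = v then u else x)
      in \<lparr>nodes = f ` nodes G, edges = {f ` e | e. e \<in> edges G \<and> card (f ` e) = 2}\<rparr>)"

inductive minor_step :: "'a sgraph \<Rightarrow> 'a sgraph \<Rightarrow> bool" where
  edge_deletion: "e \<in> edges G \<Longrightarrow> minor_step G (delete_edge e G)"
| edge_contraction: "adj G u v \<Longrightarrow> minor_step G (contract_edge u v G)"
| node_deletion: "v \<in> nodes G \<Longrightarrow> minor_step G (delete_node v G)"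

text \<open>Minors are taken up to isomorphism, so the two graphs may live on different types.\<close>

definition graph_minor :: "'a sgraph \<Rightarrow> 'b sgraph \<Rightarrow> bool" where
  "graph_minor M G \<longleftrightarrow> (\<exists>H. minor_step\<^sup>*\<^sup>* G H \<and> graph_iso M H)"

text \<open>The trees range over \<open>nat sgraph\<close>, which contains a copy of every finite tree.\<close>

definition strong_largeur :: "'a sgraph \<Rightarrow> nat" where
  "strong_largeur G =
     (LEAST k. 1 \<le> k \<and> (\<exists>T :: nat sgraph. graph_tree T \<and> graph_minor G (T \<boxtimes> complete_graph k)))"

definition psd_matrix :: "real^'n^'n \<Rightarrow> bool" where
  "psd_matrix X \<longleftrightarrow> transpose X = X \<and> (\<forall>x. 0 \<le> x \<bullet> (X *v x))"

definition sdp_feasible :: "real^'n^'n \<Rightarrow> bool" where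
  "sdp_feasible X \<longleftrightarrow> psd_matrix X \<and> (\<forall>i. X $ i $ i = 1)"

text \<open>The ordered pairs \<open>(i, j)\<close> and \<open>(j, i)\<close> represent the same edge, hence the factor
  \<open>1/2\<close>: for symmetric \<open>X\<close> this is the sum over edges of \<open>w e\<close> times the entry of \<open>X\<close> at \<open>e\<close>.\<close>

definition sdp_objective :: "'n sgraph \<Rightarrow> ('n set \<Rightarrow> real) \<Rightarrow> real^'n^'n \<Rightarrow> real" where
  "sdp_objective G w X = (\<Sum>(i, j) \<in> {(i, j). adj G i j}. w {i, j} * X $ i $ j) / 2"

definition sdp_optimal :: "'n sgraph \<Rightarrow> ('n set \<Rightarrow> real) \<Rightarrow> real^'n^'n \<Rightarrow> bool" where
  "sdp_optimal G w X \<longleftrightarrow>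
     sdp_feasible X \<and> (\<forall>Y. sdp_feasible Y \<longrightarrow> sdp_objective G w Y \<le> sdp_objective G w X)"

text \<open>Intended for graphs whose node set is the whole index type \<open>'n\<close>, in the role of \<open>[n]\<close>.
  Only the values of \<open>w\<close> on edges matter.\<close>

definition egd :: "('n::finite) sgraph \<Rightarrow> nat" where
  "egd G = (LEAST r. 1 \<le> r \<and> (\<forall>w. \<exists>X. sdp_optimal G w X \<and> rank X \<le> r))"

end

theory Submission
  imports Defs "Jordan_Normal_Form.Char_Poly"
begin

text \<open>
  The stress, or dual slack matrix, \<open>Z = Diag(y) - A\<close> of an optimal \<open>X\<close> for the weights \<open>A\<close> is positive
  semidefinite and satisfies \<open>Z X = 0\<close>. A bound on the dimension of the kernel of \<open>Z\<close> therefore bounds the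
  rank of \<open>X\<close>. Here the stress is written down from \<open>X\<close>, and its
  semidefiniteness is the second-order optimality condition for moving the vectors of a Gram
  representation of \<open>X\<close> into a fresh dimension (\<open>stress_psd\<close>).

  On \<open>T \<boxtimes> K\<^sub>k\<close> the matrix \<open>Z\<close> consists of \<open>k\<close> by \<open>k\<close> blocks, one for each pair of equal or adjacent nodes of
  the tree \<open>T\<close>. Suppose that the blocks along the edges of \<open>T\<close> are nonsingular. Then a kernel vector of \<open>Z\<close> that
  vanishes on the \<open>k\<close> copies of one tree node \<open>s\<close> vanishes on those of each neighbour
  (\<open>kernel_spreads_along_edge\<close>): deleting \<open>s\<close> cuts the tree, so by semidefiniteness the restriction of
  the vector to each branch is again in the kernel, and the rows at \<open>s\<close> isolate the block of a single
  neighbour. By connectedness the vector is zero. Hence the kernel has dimension at most \<open>k\<close>, and \<open>X\<close> has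
  a Gram representation in dimension \<open>k\<close> (\<open>gram_from_root\<close>).

  Arbitrary weights are limits of weights with nonsingular blocks (\<open>finite_singular_shifts\<close>), and
  optimal solutions of rank at most \<open>k\<close> survive limits because unit vectors in dimension \<open>k\<close> form a
  compact set (\<open>gram_compactness\<close>). The existence of such solutions for all weights passes to minors. Deletions
  amount to zero weights (\<open>low_rank_optima_embedding\<close>). A contraction is the limit of an increasingly large weight on the
  contracted edge, which forces the vectors of its two ends to coincide
  (\<open>low_rank_optima_contract_edge\<close>).
\<close>

section \<open>Positive semidefinite kernels and Gram representations\<close>

definition pairing :: "'a set \<Rightarrow> ('a \<Rightarrow> 'a \<Rightarrow> real) \<Rightarrow> ('a \<Rightarrow> 'a \<Rightarrow> real) \<Rightarrow> real" where
  "pairing V A X = (\<Sum>i\<in>V. \<Sum>j\<in>V. A i j * X i j)"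

abbreviation quad :: "'a set \<Rightarrow> ('a \<Rightarrow> 'a \<Rightarrow> real) \<Rightarrow> ('a \<Rightarrow> real) \<Rightarrow> real" where
  "quad V A x \<equiv> pairing V A (\<lambda>i j. x i * x j)"

text \<open>Kernels on a finite set of nodes of any type stand in for matrices: the minors of
  \<open>T \<boxtimes> K\<^sub>k\<close> have varying numbers of nodes, which an index type could not follow.\<close>

definition psd_on :: "'a set \<Rightarrow> ('a \<Rightarrow> 'a \<Rightarrow> real) \<Rightarrow> bool" where
  "psd_on V X \<longleftrightarrow> (\<forall>i\<in>V. \<forall>j\<in>V. X i j = X j i) \<and> (\<forall>x. 0 \<le> quad V X x)"

definition gram :: "nat \<Rightarrow> ('a \<Rightarrow> nat \<Rightarrow> real) \<Rightarrow> 'a \<Rightarrow> 'a \<Rightarrow> real" where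
  "gram d g i j = (\<Sum>c<d. g i c * g j c)"

lemma psd_on_sym: "psd_on V X \<Longrightarrow> i \<in> V \<Longrightarrow> j \<in> V \<Longrightarrow> X i j = X j i"
  by (simp add: psd_on_def)

lemma psd_on_quad: "psd_on V X \<Longrightarrow> 0 \<le> quad V X x"
  by (simp add: psd_on_def)

lemma pairing_cong:
  "(\<And>i j. i \<in> V \<Longrightarrow> j \<in> V \<Longrightarrow> A i j * X i j = B i j * Y i j) \<Longrightarrow> pairing V A X = pairing V B Y"
  by (simp add: pairing_def)

lemma psd_on_cong:
  assumes "\<And>i j. i \<in> V \<Longrightarrow> j \<in> V \<Longrightarrow> X i j = Y i j"
  shows "psd_on V X \<longleftrightarrow> psd_on V Y"
proof -
  have "quad V X x = quad V Y x" for x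
    by (rule pairing_cong) (simp add: assms)
  with assms show ?thesis by (simp add: psd_on_def)
qed

text \<open>The coordinates of a Gram representation split the pairing into quadratic forms. This is
  how information about \<open>pairing V Z X\<close> turns into information about kernel vectors of \<open>Z\<close>.\<close>

lemma pairing_gram: "pairing V A (gram d g) = (\<Sum>c<d. quad V A (\<lambda>i. g i c))"
  unfolding pairing_def gram_def sum_distrib_left
  by (subst sum.swap[of _ _ V], subst (2) sum.swap) (rule refl)

lemma psd_on_gram: "psd_on V (gram d g)"
proof -
  have "quad V (gram d g) x = (\<Sum>c<d. (\<Sum>i\<in>V. x i * g i c)\<^sup>2)" for x
  proof -
    have "quad V (gram d g) x = pairing V (\<lambda>i j. x i * x j) (gram d g)"
      by (rule pairing_cong) simp
    also have "\<dots> = (\<Sum>c<d. (\<Sum>i\<in>V. x i * g i c)\<^sup>2)"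
      unfolding pairing_gram unfolding pairing_def power2_eq_square sum_product
      by (intro sum.cong refl) (simp add: algebra_simps)
    finally show ?thesis .
  qed
  then show ?thesis
    by (simp add: psd_on_def sum_nonneg) (simp add: gram_def mult.commute)
qed

lemma quad_shift:
  assumes "finite V" "a \<in> V" "\<And>i. i \<in> V \<Longrightarrow> X i a = X a i"
  shows "quad V X (\<lambda>i. x i + t * of_bool (i = a))
    = quad V X x + 2 * t * (\<Sum>i\<in>V. X i a * x i) + t\<^sup>2 * X a a"
proof -
  have "quad V X (\<lambda>i. x i + t * of_bool (i = a))
      = (\<Sum>i\<in>V. \<Sum>j\<in>V. X i j * (x i * x j) + (if j = a then t * (X i j * x i) else 0)
          + (if i = a then t * (X i j * x j) else 0)
          + (if i = a then (if j = a then t\<^sup>2 * X i j else 0) else 0))"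
    unfolding pairing_def
    by (intro sum.cong refl) (simp add: algebra_simps power2_eq_square)
  also have "\<dots> = quad V X x + (\<Sum>i\<in>V. t * (X i a * x i)) + (\<Sum>j\<in>V. t * (X a j * x j)) + t\<^sup>2 * X a a"
  proof -
    have "(\<Sum>i\<in>V. \<Sum>j\<in>V. if i = a then t * (X i j * x j) else 0)
        = (\<Sum>j\<in>V. t * (X a j * x j))"
      using assms(1,2) by (subst sum.swap) simp
    moreover have "(\<Sum>i\<in>V. \<Sum>j\<in>V. if i = a then (if j = a then t\<^sup>2 * X i j else 0) else 0)
        = t\<^sup>2 * X a a"
      using assms(1,2) by (subst sum.swap) simp
    ultimately show ?thesis using assms(1,2) by (simp add: sum.distrib pairing_def)
  qed
  also have "(\<Sum>j\<in>V. t * (X a j * x j)) = (\<Sum>i\<in>V. t * (X i a * x i))"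
    by (intro sum.cong refl) (metis assms(3))
  finally show ?thesis by (simp add: sum_distrib_left mult.assoc)
qed

lemma quad_indicator:
  assumes "finite V" "a \<in> V"
  shows "quad V X (\<lambda>i. of_bool (i = a)) = X a a"
proof -
  have "quad V X (\<lambda>i. of_bool (i = a))
     = (\<Sum>i\<in>V. \<Sum>j\<in>V. if i = a then (if j = a then X i j else 0) else 0)"
    unfolding pairing_def by (intro sum.cong refl) simp
  also have "\<dots> = X a a" using assms by (subst sum.swap) simp
  finally show ?thesis .
qed

lemma quad_two:
  assumes "finite V" "psd_on V X" "a \<in> V" "i \<in> V"
  shows "0 \<le> X i i + 2 * t * X i a + t\<^sup>2 * X a a"
proof -
  have "0 \<le> quad V X (\<lambda>j. of_bool (j = i) + t * of_bool (j = a))"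
    by (rule psd_on_quad) fact
  also have "\<dots> = X i i + 2 * t * (\<Sum>j\<in>V. X j a * of_bool (j = i)) + t\<^sup>2 * X a a"
    using assms by (subst quad_shift) (auto simp: quad_indicator psd_on_sym)
  also have "(\<Sum>j\<in>V. X j a * of_bool (j = i)) = (\<Sum>j\<in>V. if j = i then X j a else 0)"
    by (intro sum.cong) auto
  also have "\<dots> = X i a" using assms by simp
  finally show ?thesis .
qed

lemma psd_on_diag_nonneg:
  assumes "finite V" "psd_on V X" "a \<in> V"
  shows "0 \<le> X a a"
  using psd_on_quad[OF assms(2)] quad_indicator[OF assms(1,3)] by metis

text \<open>Otherwise the quadratic form on the coordinates \<open>i\<close> and \<open>a\<close> would be linear and
  nonconstant in the entry at \<open>a\<close>, hence unbounded below.\<close>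

lemma psd_on_zero_diag:
  assumes "finite V" "psd_on V X" "a \<in> V" "X a a = 0" "i \<in> V"
  shows "X i a = 0"
proof (rule ccontr)
  assume n: "X i a \<noteq> 0"
  have "0 \<le> X i i + 2 * (- (X i i + 1) / (2 * X i a)) * X i a"
    using quad_two[OF assms(1-3,5), of "- (X i i + 1) / (2 * X i a)"] assms(4) by simp
  also have "\<dots> = -1" using n by (simp add: field_simps)
  finally show False by simp
qed

text \<open>Completing the square: the form of the Schur complement at \<open>x\<close> is the minimum of the form
  of \<open>X\<close> over all changes of the coordinate \<open>x a\<close>. If \<open>X a a = 0\<close>, the column of \<open>a\<close> vanishes and
  so does the quotient.\<close>

lemma psd_on_schur:
  assumes "finite V" "psd_on V X" "a \<in> V"
  shows "psd_on V (\<lambda>i j. X i j - X i a * X j a / X a a)"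
proof -
  have "0 \<le> quad V (\<lambda>i j. X i j - X i a * X j a / X a a) x" for x
  proof -
    define s where "s = (\<Sum>i\<in>V. X i a * x i)"
    have "quad V (\<lambda>i j. X i j - X i a * X j a / X a a) x
        = quad V X x - (\<Sum>i\<in>V. \<Sum>j\<in>V. (X i a * x i) * (X j a * x j)) / X a a"
      unfolding pairing_def sum_divide_distrib sum_subtractf[symmetric]
      by (intro sum.cong refl) (simp add: field_simps diff_divide_distrib)
    also have "\<dots> = quad V X x - s\<^sup>2 / X a a"
      by (simp add: s_def power2_eq_square sum_product)
    finally have 1: "quad V (\<lambda>i j. X i j - X i a * X j a / X a a) x = quad V X x - s\<^sup>2 / X a a" .
    have "0 \<le> quad V X (\<lambda>i. x i + (- s / X a a) * of_bool (i = a))"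
      by (rule psd_on_quad) fact
    also have "\<dots> = quad V X x + 2 * (- s / X a a) * s + (- s / X a a)\<^sup>2 * X a a"
      using assms by (subst quad_shift) (auto simp: psd_on_sym s_def)
    also have "\<dots> = quad V X x - s\<^sup>2 / X a a"
      by (cases "X a a = 0") (simp_all add: field_simps power2_eq_square)
    finally show ?thesis using 1 by simp
  qed
  moreover have "X i j - X i a * X j a / X a a = X j i - X j a * X i a / X a a"
    if "i \<in> V" "j \<in> V" for i j
    using psd_on_sym[OF assms(2) that] by (simp only: mult.commute)
  ultimately show ?thesis by (simp add: psd_on_def)
qed

text \<open>Each index of \<open>R\<close> is eliminated by one Schur complement at the cost of one Gram
  coordinate, and what remains vanishes on \<open>R\<close>. Taking \<open>R\<close> to be all of \<open>V\<close> gives a Gram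
  representation; taking a small \<open>R\<close> gives one in few dimensions as soon as the remainder can be
  shown to vanish.\<close>

lemma partial_cholesky:
  assumes "finite V" "psd_on V X" "R \<subseteq> V"
  shows "\<exists>g Y. psd_on V Y \<and> (\<forall>i\<in>R. Y i i = 0) \<and>
    (\<forall>i\<in>V. \<forall>j\<in>V. X i j = gram (card R) g i j + Y i j)"
proof -
  have "finite R" using assms finite_subset by blast
  from this assms(3) show ?thesis
  proof (induction R)
    case empty
    then show ?case using assms(2) by (auto simp: gram_def)
  next
    case (insert a R)
    then obtain g Y where Y: "psd_on V Y" "\<forall>i\<in>R. Y i i = 0"
      and X: "\<forall>i\<in>V. \<forall>j\<in>V. X i j = gram (card R) g i j + Y i j" by auto
    have a: "a \<in> V" and RV: "R \<subseteq> V" using insert by auto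
    define Y' where "Y' i j = Y i j - Y i a * Y j a / Y a a" for i j
    define g' where "g' i c = (if c = card R then Y i a / sqrt (Y a a) else g i c)" for i c
    have "psd_on V Y'" unfolding Y'_def using assms(1) Y(1) a by (rule psd_on_schur)
    moreover have "Y' i i = 0" if "i \<in> insert a R" for i
    proof (cases "i = a")
      case False
      then have "Y i i = 0" "i \<in> V" using that Y RV by auto
      then have "Y a i = 0" using psd_on_zero_diag assms(1) Y(1) a by metis
      then have "Y i a = 0" using psd_on_sym[OF Y(1) a \<open>i \<in> V\<close>] by simp
      then show ?thesis using \<open>Y i i = 0\<close> by (simp add: Y'_def)
    qed (simp add: Y'_def)
    moreover have "X i j = gram (card (insert a R)) g' i j + Y' i j" if "i \<in> V" "j \<in> V" for i j
    proof -
      have "gram (card R) g' i j = gram (card R) g i j"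
        unfolding gram_def by (intro sum.cong) (auto simp: g'_def)
      moreover have "g' i (card R) * g' j (card R) = Y i a * Y j a / Y a a"
        using psd_on_diag_nonneg[OF assms(1) Y(1) a] by (simp add: g'_def)
      ultimately have "gram (card (insert a R)) g' i j = gram (card R) g i j + Y i a * Y j a / Y a a"
        using insert.hyps by (simp add: gram_def)
      then show ?thesis using X that by (simp add: Y'_def)
    qed
    ultimately show ?case by blast
  qed
qed

lemma psd_on_imp_gram:
  assumes "finite V" "psd_on V X"
  obtains g where "\<And>i j. i \<in> V \<Longrightarrow> j \<in> V \<Longrightarrow> X i j = gram (card V) g i j"
proof -
  obtain g Y where Y: "psd_on V Y" "\<forall>i\<in>V. Y i i = 0"
    and X: "\<forall>i\<in>V. \<forall>j\<in>V. X i j = gram (card V) g i j + Y i j"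
    using partial_cholesky[OF assms order_refl] by blast
  have "Y i j = 0" if "i \<in> V" "j \<in> V" for i j
    using psd_on_zero_diag[OF assms(1) Y(1)] Y(2) that by blast
  with X show ?thesis using that by force
qed

lemma psd_on_pullback:
  assumes "finite V" "psd_on V X" "f ` W \<subseteq> V"
  shows "psd_on W (\<lambda>i j. X (f i) (f j))"
proof -
  obtain g where g: "\<And>i j. i \<in> V \<Longrightarrow> j \<in> V \<Longrightarrow> X i j = gram (card V) g i j"
    using psd_on_imp_gram[OF assms(1,2)] by blast
  have "X (f i) (f j) = gram (card V) (\<lambda>i. g (f i)) i j" if "i \<in> W" "j \<in> W" for i j
  proof -
    have "f i \<in> V" "f j \<in> V" using that assms(3) by blast+
    from g[OF this] show ?thesis by (simp add: gram_def)
  qed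
  then have "psd_on W (\<lambda>i j. X (f i) (f j)) \<longleftrightarrow> psd_on W (gram (card V) (\<lambda>i. g (f i)))"
    by (rule psd_on_cong)
  with psd_on_gram show ?thesis by blast
qed

lemma psd_pairing_nonneg:
  assumes "finite V" "psd_on V Z" "psd_on V X"
  shows "0 \<le> pairing V Z X"
proof -
  obtain g where g: "\<And>i j. i \<in> V \<Longrightarrow> j \<in> V \<Longrightarrow> X i j = gram (card V) g i j"
    using psd_on_imp_gram[OF assms(1,3)] by blast
  have "pairing V Z X = pairing V Z (gram (card V) g)"
    by (rule pairing_cong) (simp add: g)
  also have "0 \<le> \<dots>" unfolding pairing_gram by (intro sum_nonneg psd_on_quad assms)
  finally show ?thesis .
qed

section \<open>Correlation kernels and maximisers\<close>

definition correlation :: "'a set \<Rightarrow> ('a \<Rightarrow> 'a \<Rightarrow> real) \<Rightarrow> bool" where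
  "correlation V X \<longleftrightarrow> psd_on V X \<and> (\<forall>i\<in>V. X i i = 1)"

lemma correlation_bound:
  assumes "finite V" "correlation V X" "i \<in> V" "j \<in> V"
  shows "\<bar>X i j\<bar> \<le> 1"
  using quad_two[of V X j i 1] quad_two[of V X j i "-1"] assms
  by (auto simp: correlation_def)

lemma pairing_bound:
  assumes "finite V" "correlation V X"
  shows "\<bar>pairing V A X\<bar> \<le> (\<Sum>i\<in>V. \<Sum>j\<in>V. \<bar>A i j\<bar>)"
  unfolding pairing_def
  apply (rule order_trans[OF sum_abs], rule sum_mono)
  apply (rule order_trans[OF sum_abs], rule sum_mono)
  using correlation_bound[OF assms] by (simp add: abs_mult mult_left_le)

lemma correlation_pullback:
  assumes "finite V" "correlation V X" "f ` W \<subseteq> V"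
  shows "correlation W (\<lambda>i j. X (f i) (f j))"
  using psd_on_pullback[OF assms(1) _ assms(3)] assms(2,3) by (auto simp: correlation_def)

lemma correlation_cong:
  assumes "\<And>i j. i \<in> V \<Longrightarrow> j \<in> V \<Longrightarrow> X i j = Y i j"
  shows "correlation V X \<longleftrightarrow> correlation V Y"
proof -
  have "psd_on V X \<longleftrightarrow> psd_on V Y" by (rule psd_on_cong) (rule assms)
  moreover have "(\<forall>i\<in>V. X i i = 1) \<longleftrightarrow> (\<forall>i\<in>V. Y i i = 1)" using assms by force
  ultimately show ?thesis by (simp add: correlation_def)
qed

text \<open>Representations by unit vectors in a fixed dimension form a compact set, so a limit of
  kernels of rank at most \<open>d\<close> again has rank at most \<open>d\<close>. All limit arguments below use this.\<close>

lemma gram_compactness: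
  fixes g :: "nat \<Rightarrow> 'a \<Rightarrow> nat \<Rightarrow> real"
  assumes "finite V" "\<And>m. correlation V (gram d (g m))"
  obtains h r where "strict_mono r" "correlation V (gram d h)"
    "\<And>i j. i \<in> V \<Longrightarrow> j \<in> V \<Longrightarrow> (\<lambda>m. gram d (g (r m)) i j) \<longlonglongrightarrow> gram d h i j"
proof -
  have bd: "\<bar>g m i c\<bar> \<le> 1" if "i \<in> V" "c < d" for m i c
  proof -
    have "(g m i c)\<^sup>2 \<le> (\<Sum>c<d. (g m i c)\<^sup>2)"
      using that by (intro member_le_sum) auto
    also have "\<dots> = 1" using assms(2)[of m] that by (simp add: correlation_def gram_def power2_eq_square)
    finally show ?thesis by (simp add: abs_square_le_1)
  qed
  have "\<exists>l::'a \<times> nat \<Rightarrow> real. \<exists>r::nat\<Rightarrow>nat. strict_mono r \<and>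
     (\<forall>e>0. eventually (\<lambda>n. \<forall>p\<in>V \<times> {..<d}. dist (case_prod (g (r n)) p) (l p) < e) sequentially)"
  proof (rule compact_lemma_general[where basis = "V \<times> {..<d}" and f = "\<lambda>n. case_prod (g n)"
         and proj = "\<lambda>x. x" and unproj = "\<lambda>x. x", THEN spec, THEN mp])
    fix p assume "p \<in> V \<times> {..<d}"
    then show "bounded ((\<lambda>x. x p) ` range (\<lambda>n. case_prod (g n)))"
      using bd by (intro boundedI[of _ 1]) auto
  qed (use assms(1) in auto)
  then obtain l :: "'a \<times> nat \<Rightarrow> real" and r where r: "strict_mono r" and
    e: "\<And>e. e > 0 \<Longrightarrow> eventually (\<lambda>n. \<forall>p\<in>V \<times> {..<d}. dist (case_prod (g (r n)) p) (l p) < e) sequentially"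
    by blast
  define h where "h = curry l"
  have lim: "(\<lambda>n. g (r n) i c) \<longlonglongrightarrow> h i c" if "i \<in> V" "c < d" for i c
  proof (rule tendstoI)
    fix x :: real assume "x > 0"
    from e[OF this] show "eventually (\<lambda>n. dist (g (r n) i c) (h i c) < x) sequentially"
      by eventually_elim (use that in \<open>auto simp: h_def\<close>)
  qed
  have glim: "(\<lambda>m. gram d (g (r m)) i j) \<longlonglongrightarrow> gram d h i j" if "i \<in> V" "j \<in> V" for i j
    unfolding gram_def using that by (intro tendsto_sum tendsto_mult lim) auto
  have "gram d h i i = 1" if "i \<in> V" for i
  proof -
    have "(\<lambda>m. gram d (g (r m)) i i) = (\<lambda>m. 1)"
      using assms(2) that by (simp add: correlation_def)
    then show ?thesis using glim[OF that that] LIMSEQ_const_iff by metis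
  qed
  then have "correlation V (gram d h)" by (simp add: correlation_def psd_on_gram)
  with r glim show ?thesis using that by blast
qed

lemma pairing_tendsto:
  assumes "\<And>i j. i \<in> V \<Longrightarrow> j \<in> V \<Longrightarrow> (\<lambda>m. A m i j) \<longlonglongrightarrow> B i j"
    and "\<And>i j. i \<in> V \<Longrightarrow> j \<in> V \<Longrightarrow> (\<lambda>m. X m i j) \<longlonglongrightarrow> Y i j"
  shows "(\<lambda>m. pairing V (A m) (X m)) \<longlonglongrightarrow> pairing V B Y"
  unfolding pairing_def by (intro tendsto_sum tendsto_mult assms)

text \<open>The competitors are all correlation kernels, hence unit vectors in every dimension,
  while the maximiser has to live in dimension \<open>d\<close>.\<close>

definition gram_maximal :: "nat \<Rightarrow> 'a set \<Rightarrow> ('a \<Rightarrow> 'a \<Rightarrow> real) \<Rightarrow> ('a \<Rightarrow> nat \<Rightarrow> real) \<Rightarrow> bool" where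
  "gram_maximal d V A g \<longleftrightarrow> correlation V (gram d g) \<and>
     (\<forall>X. correlation V X \<longrightarrow> pairing V A X \<le> pairing V A (gram d g))"

text \<open>Every positive semidefinite kernel has a Gram representation in dimension \<open>card V\<close>, so
  a maximising sequence may be taken there and compactness applies.\<close>

lemma ex_gram_maximal:
  assumes "finite V"
  shows "\<exists>g. gram_maximal (card V) V A g"
proof -
  let ?S = "pairing V A ` {X. correlation V X}"
  have ne: "?S \<noteq> {}"
  proof -
    have "correlation V (gram 1 (\<lambda>i c. 1))" by (simp add: correlation_def psd_on_gram) (simp add: gram_def)
    then show ?thesis by blast
  qed
  have bdd: "bdd_above ?S"
    by (rule bdd_aboveI2[where M = "\<Sum>i\<in>V. \<Sum>j\<in>V. \<bar>A i j\<bar>"])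
       (use pairing_bound[OF assms] in \<open>force simp: abs_le_iff\<close>)
  have "\<exists>g. correlation V (gram (card V) g) \<and> Sup ?S - 1 / real (Suc m) < pairing V A (gram (card V) g)" for m
  proof -
    obtain X where X: "correlation V X" "Sup ?S - 1 / real (Suc m) < pairing V A X"
      using less_cSup_iff[OF ne bdd, of "Sup ?S - 1 / real (Suc m)"] by auto
    then obtain g where g: "\<And>i j. i \<in> V \<Longrightarrow> j \<in> V \<Longrightarrow> X i j = gram (card V) g i j"
      using psd_on_imp_gram[OF assms] by (auto simp: correlation_def)
    have "pairing V A X = pairing V A (gram (card V) g)" by (rule pairing_cong) (simp add: g)
    then show ?thesis using X correlation_cong[of V X "gram (card V) g"] g by auto
  qed
  then have "\<exists>g. \<forall>m. correlation V (gram (card V) (g m)) \<and>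
      Sup ?S - 1 / real (Suc m) < pairing V A (gram (card V) (g m))"
    by (intro choice allI)
  then obtain g where g0: "\<forall>m. correlation V (gram (card V) (g m)) \<and>
      Sup ?S - 1 / real (Suc m) < pairing V A (gram (card V) (g m))" ..
  have g: "correlation V (gram (card V) (g m))"
     "Sup ?S - 1 / real (Suc m) < pairing V A (gram (card V) (g m))" for m
    using g0[THEN spec, of m, THEN conjunct1] g0[THEN spec, of m, THEN conjunct2] .
  obtain h r where r: "strict_mono r" and h: "correlation V (gram (card V) h)"
    and lim: "\<And>i j. i \<in> V \<Longrightarrow> j \<in> V \<Longrightarrow> (\<lambda>m. gram (card V) (g (r m)) i j) \<longlonglongrightarrow> gram (card V) h i j"
    by (rule gram_compactness[OF assms, where g = g and d = "card V"]) (use g(1) in auto)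
  have "(\<lambda>m. Sup ?S - 1 / real (Suc (r m))) \<longlonglongrightarrow> Sup ?S - 0"
    using LIMSEQ_subseq_LIMSEQ[OF LIMSEQ_Suc[OF lim_const_over_n[of 1]] r]
    by (intro tendsto_diff tendsto_const) (simp add: o_def)
  moreover have "(\<lambda>m. pairing V A (gram (card V) (g (r m)))) \<longlonglongrightarrow> pairing V A (gram (card V) h)"
    by (intro pairing_tendsto lim tendsto_const)
  ultimately have "Sup ?S - 0 \<le> pairing V A (gram (card V) h)"
    by (rule LIMSEQ_le) (use g(2) in \<open>auto intro: less_imp_le\<close>)
  then have "gram_maximal (card V) V A h"
    using h cSup_upper[OF _ bdd] by (force simp: gram_maximal_def)
  then show ?thesis by blast
qed

section \<open>Optimality certificates\<close>

text \<open>This is the dual slack matrix \<open>Diag(y) - A\<close>, with the multipliers \<open>y\<close> read off from the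
  primal solution \<open>X\<close>.\<close>

definition stress :: "'a set \<Rightarrow> ('a \<Rightarrow> 'a \<Rightarrow> real) \<Rightarrow> ('a \<Rightarrow> 'a \<Rightarrow> real) \<Rightarrow> 'a \<Rightarrow> 'a \<Rightarrow> real" where
  "stress V A X i j = (if i = j then \<Sum>l\<in>V. A i l * X i l else 0) - A i j"

lemma pairing_stress:
  assumes "finite V"
  shows "pairing V (stress V A X) Y = pairing V A (\<lambda>i j. X i j * Y i i) - pairing V A Y"
proof -
  have "pairing V (stress V A X) Y
      = (\<Sum>i\<in>V. \<Sum>j\<in>V. (if i = j then (\<Sum>l\<in>V. A i l * X i l) * Y i j else 0) - A i j * Y i j)"
    unfolding pairing_def stress_def by (intro sum.cong refl) (simp add: algebra_simps)
  also have "\<dots> = pairing V A (\<lambda>i j. X i j * Y i i) - pairing V A Y"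
    using assms by (simp add: pairing_def sum_subtractf sum_distrib_right mult.assoc)
  finally show ?thesis .
qed

text \<open>The numerator is rationalised with \<open>1 + sqrt (1 - t\<^sup>2 * a) * sqrt (1 - t\<^sup>2 * b)\<close>.\<close>

lemma sqrt_product_limit:
  fixes a b :: real
  shows "((\<lambda>t. (1 - sqrt (1 - t\<^sup>2 * a) * sqrt (1 - t\<^sup>2 * b)) / t\<^sup>2) \<longlongrightarrow> (a + b) / 2) (at_right 0)"
proof (rule Lim_transform_eventually)
  show "((\<lambda>t. (a + b - t\<^sup>2 * a * b) / (1 + sqrt (1 - t\<^sup>2 * a) * sqrt (1 - t\<^sup>2 * b)))
      \<longlongrightarrow> (a + b) / 2) (at_right 0)"
    by (auto intro!: tendsto_eq_intros)
  have lim: "((\<lambda>t. 1 - t\<^sup>2 * c) \<longlongrightarrow> 1 - 0\<^sup>2 * c) (at_right 0)" for c :: real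
    by (intro tendsto_intros)
  have "eventually (\<lambda>t. 0 < 1 - t\<^sup>2 * c) (at_right 0)" for c :: real
    using order_tendstoD(1)[OF lim, of 0] by simp
  from this[of a] this[of b] eventually_at_right_less
  show "eventually (\<lambda>t. (a + b - t\<^sup>2 * a * b) / (1 + sqrt (1 - t\<^sup>2 * a) * sqrt (1 - t\<^sup>2 * b))
      = (1 - sqrt (1 - t\<^sup>2 * a) * sqrt (1 - t\<^sup>2 * b)) / t\<^sup>2) (at_right 0)"
  proof eventually_elim
    case (elim t)
    define u where "u = sqrt (1 - t\<^sup>2 * a) * sqrt (1 - t\<^sup>2 * b)"
    have "u > 0" using elim by (simp add: u_def)
    have "u\<^sup>2 = (1 - t\<^sup>2 * a) * (1 - t\<^sup>2 * b)" using elim by (simp add: u_def power_mult_distrib)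
    then have "(1 - u) * (1 + u) = t\<^sup>2 * (a + b - t\<^sup>2 * a * b)"
      by (simp add: algebra_simps power2_eq_square)
    then have "(a + b - t\<^sup>2 * a * b) / (1 + u) = (1 - u) / t\<^sup>2"
      using \<open>u > 0\<close> elim by (simp add: field_simps)
    then show ?case by (simp add: u_def)
  qed
qed

text \<open>The second-order optimality condition, in place of semidefinite duality. If \<open>X\<close> is the Gram
  kernel of unit vectors \<open>u\<^sub>i\<close>, tilt \<open>u\<^sub>i\<close> by \<open>t * x i\<close> into a fresh direction \<open>e\<close> orthogonal to all of
  them and shrink \<open>u\<^sub>i\<close> to keep unit length. The objective changes by \<open>- t\<^sup>2\<close> times the quadratic
  form of the stress at \<open>x\<close> up to higher order terms, and it cannot increase.\<close>

lemma stress_psd: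
  assumes V: "finite V" and A: "\<And>i j. A i j = A j i" and X: "correlation V X"
    and max: "\<And>Y. correlation V Y \<Longrightarrow> pairing V A Y \<le> pairing V A X"
  shows "psd_on V (stress V A X)"
proof -
  have "0 \<le> quad V (stress V A X) x" for x
  proof -
    define s where "s t i = sqrt (1 - t\<^sup>2 * (x i)\<^sup>2)" for t i
    have small: "eventually (\<lambda>t. \<forall>i\<in>V. t\<^sup>2 * (x i)\<^sup>2 < 1) (at_right 0)"
    proof (intro eventually_ball_finite[OF V] ballI)
      fix i
      have "((\<lambda>t. t\<^sup>2 * (x i)\<^sup>2) \<longlongrightarrow> 0\<^sup>2 * (x i)\<^sup>2) (at_right 0)" by (intro tendsto_intros)
      from order_tendstoD(2)[OF this, of 1]
      show "eventually (\<lambda>t. t\<^sup>2 * (x i)\<^sup>2 < 1) (at_right 0)" by simp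
    qed
    have ev: "eventually (\<lambda>t. quad V A x \<le> pairing V A (\<lambda>i j. X i j * ((1 - s t i * s t j) / t\<^sup>2))) (at_right 0)"
      using small eventually_at_right_less[of 0]
    proof eventually_elim
      case (elim t)
      \<comment> \<open>The Gram kernel of the tilted vectors \<open>s t i u\<^sub>i + t (x i) e\<close>.\<close>
      let ?Y = "\<lambda>i j. s t i * s t j * X i j + t\<^sup>2 * (x i * x j)"
      have "correlation V ?Y"
      proof -
        have "0 \<le> quad V ?Y z" for z
        proof -
          have "(\<Sum>i\<in>V. x i * z i)\<^sup>2 = (\<Sum>i\<in>V. \<Sum>j\<in>V. (x i * z i) * (x j * z j))"
            by (simp only: power2_eq_square sum_product)
          then have "quad V ?Y z = quad V X (\<lambda>i. s t i * z i) + t\<^sup>2 * (\<Sum>i\<in>V. x i * z i)\<^sup>2"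
            unfolding pairing_def by (simp add: sum_distrib_left sum.distrib[symmetric])
              (intro sum.cong refl, simp add: algebra_simps)
          then show ?thesis using X psd_on_quad[of V X] by (simp add: correlation_def)
        qed
        moreover have "?Y i j = ?Y j i" if "i \<in> V" "j \<in> V" for i j
          using psd_on_sym[of V X i j] X that by (simp add: correlation_def mult.commute)
        moreover have "?Y i i = 1" if "i \<in> V" for i
        proof -
          have "s t i * s t i = 1 - t\<^sup>2 * (x i)\<^sup>2"
            using elim that by (simp add: s_def less_imp_le)
          then show ?thesis using X that by (simp add: correlation_def power2_eq_square)
        qed
        ultimately show ?thesis unfolding correlation_def psd_on_def by blast
      qed
      from max[OF this] have "pairing V A ?Y \<le> pairing V A X" .
      moreover have "pairing V A ?Y
          = pairing V A X - t\<^sup>2 * pairing V A (\<lambda>i j. X i j * ((1 - s t i * s t j) / t\<^sup>2)) + t\<^sup>2 * quad V A x"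
        unfolding pairing_def sum_distrib_left sum.distrib[symmetric] sum_subtractf[symmetric]
        using elim by (intro sum.cong refl) (simp add: field_simps)
      ultimately have "t\<^sup>2 * quad V A x \<le> t\<^sup>2 * pairing V A (\<lambda>i j. X i j * ((1 - s t i * s t j) / t\<^sup>2))"
        by simp
      then show ?case using elim by (simp add: mult_le_cancel_left)
    qed
    have lim: "((\<lambda>t. pairing V A (\<lambda>i j. X i j * ((1 - s t i * s t j) / t\<^sup>2)))
        \<longlongrightarrow> pairing V A (\<lambda>i j. X i j * (((x i)\<^sup>2 + (x j)\<^sup>2) / 2))) (at_right 0)"
      unfolding pairing_def s_def by (intro tendsto_intros sqrt_product_limit)
    have le: "quad V A x \<le> pairing V A (\<lambda>i j. X i j * (((x i)\<^sup>2 + (x j)\<^sup>2) / 2))"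
      by (rule tendsto_lowerbound[OF lim ev]) simp
    \<comment> \<open>Symmetry of \<open>A\<close> and \<open>X\<close> exchanges the two halves of the limit.\<close>
    have sw: "pairing V A (\<lambda>i j. X i j * (x j)\<^sup>2) = pairing V A (\<lambda>i j. X i j * (x i)\<^sup>2)"
    proof -
      have "X i j = X j i" if "i \<in> V" "j \<in> V" for i j
        using psd_on_sym[of V X i j] X that by (simp add: correlation_def)
      then show ?thesis
        unfolding pairing_def by (subst sum.swap, intro sum.cong refl) (metis A)
    qed
    have "pairing V A (\<lambda>i j. X i j * (((x i)\<^sup>2 + (x j)\<^sup>2) / 2))
        = (pairing V A (\<lambda>i j. X i j * (x i)\<^sup>2) + pairing V A (\<lambda>i j. X i j * (x j)\<^sup>2)) / 2"
      unfolding pairing_def sum.distrib[symmetric] sum_divide_distrib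
      by (intro sum.cong refl) (simp add: field_simps)
    with le sw show ?thesis
      unfolding pairing_stress[OF V] by (simp add: power2_eq_square)
  qed
  then show ?thesis using A by (simp add: psd_on_def stress_def)
qed

text \<open>A zero of a nonnegative quadratic form is a minimum, so the gradient vanishes there. The
  proof evaluates the form at an explicit step against the \<open>i\<close>-th gradient coordinate.\<close>

lemma psd_on_kernel:
  assumes V: "finite V" and Z: "psd_on V Z" and x: "quad V Z x = 0" and i: "i \<in> V"
  shows "(\<Sum>j\<in>V. Z i j * x j) = 0"
proof (rule ccontr)
  define s where "s = (\<Sum>j\<in>V. Z j i * x j)"
  assume "\<not> ?thesis"
  moreover have "(\<Sum>j\<in>V. Z i j * x j) = s"
    unfolding s_def using psd_on_sym[OF Z i] by (intro sum.cong refl) auto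
  ultimately have "s \<noteq> 0" by simp
  have nn: "0 \<le> Z i i" using psd_on_diag_nonneg V Z i .
  define d where "d = Z i i + 1"
  define t where "t = - s / d"
  have d: "d > 0" "Z i i = d - 1" using nn by (simp_all add: d_def)
  have "0 \<le> quad V Z (\<lambda>j. x j + t * of_bool (j = i))" by (rule psd_on_quad) fact
  also have "\<dots> = 2 * t * s + t\<^sup>2 * Z i i"
    using psd_on_sym[OF Z] i x by (subst quad_shift[OF V i]) (auto simp: s_def)
  also have "\<dots> = - (s\<^sup>2 * (d + 1) / d\<^sup>2)"
    unfolding d(2) t_def using d(1) by (simp add: field_simps power2_eq_square)
  also have "\<dots> < 0" using d \<open>s \<noteq> 0\<close> by simp
  finally show False by simp
qed

section \<open>Kernel vectors on products with trees\<close>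

lemma rtranclp_distinct_path:
  assumes "R\<^sup>*\<^sup>* a b"
  shows "\<exists>xs. xs \<noteq> [] \<and> hd xs = a \<and> last xs = b \<and> distinct xs \<and> successively R xs"
  using assms
proof (induction rule: rtranclp_induct)
  case base
  show ?case by (rule exI[of _ "[a]"]) simp
next
  case (step y z)
  then obtain xs where xs: "xs \<noteq> []" "hd xs = a" "last xs = y" "distinct xs" "successively R xs" by blast
  show ?case
  proof (cases "z \<in> set xs")
    case True
    then obtain us vs where "xs = us @ z # vs" by (auto simp: in_set_conv_decomp)
    with xs show ?thesis
      by (intro exI[of _ "us @ [z]"]) (auto simp: successively_append_iff hd_append split: if_splits)
  next
    case False
    with xs step.hyps show ?thesis
      by (intro exI[of _ "xs @ [z]"]) (auto simp: successively_append_iff hd_append)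
  qed
qed

lemma adj_sym: "adj G i j \<Longrightarrow> adj G j i"
  by (simp add: adj_def insert_commute)

lemma adj_nodes:
  assumes "simple_graph G" "adj G i j"
  shows "i \<in> nodes G" "j \<in> nodes G" "i \<noteq> j"
  using assms by (force simp: simple_graph_def adj_def)+

text \<open>The set \<open>C\<close> is the component of \<open>T - s\<close> that contains \<open>t\<close>. A second edge from \<open>s\<close> into it
  would close a cycle with a path inside \<open>C\<close>.\<close>

lemma tree_branch:
  assumes T: "graph_tree T" and st: "adj T s t"
  obtains C where "C \<subseteq> nodes T" "t \<in> C" "s \<notin> C"
    "\<And>c d. c \<in> C \<Longrightarrow> adj T c d \<Longrightarrow> d \<in> C \<or> d = s"
    "\<And>c. c \<in> C \<Longrightarrow> adj T s c \<Longrightarrow> c = t"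
proof
  have T': "simple_graph T" "\<nexists>vs. graph_cycle T vs" using T by (auto simp: graph_tree_def)
  note nT = adj_nodes[OF T'(1)]
  define R where "R a b \<longleftrightarrow> adj T a b \<and> a \<noteq> s \<and> b \<noteq> s" for a b
  let ?C = "{c. R\<^sup>*\<^sup>* t c}"
  have C: "c \<in> nodes T \<and> c \<noteq> s" if "R\<^sup>*\<^sup>* t c" for c
    using that by (induction rule: rtranclp_induct) (use nT(2,3)[OF st] nT(2) in \<open>auto simp: R_def\<close>)
  show "?C \<subseteq> nodes T" "t \<in> ?C" "s \<notin> ?C" using C by auto
  show "d \<in> ?C \<or> d = s" if "c \<in> ?C" "adj T c d" for c d
  proof (cases "d = s")
    case False
    with that C have "R c d" by (auto simp: R_def)
    with that(1) show ?thesis by (auto intro: rtranclp.rtrancl_into_rtrancl)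
  qed simp
  show "c = t" if c: "c \<in> ?C" "adj T s c" for c
  proof (rule ccontr)
    assume "c \<noteq> t"
    from c(1) have "R\<^sup>*\<^sup>* t c" by simp
    from rtranclp_distinct_path[OF this] obtain xs where
      xs: "xs \<noteq> []" "hd xs = t" "last xs = c" "distinct xs" "successively R xs"
      by blast
    have len: "2 \<le> length xs"
      using xs(1-3) \<open>c \<noteq> t\<close> by (cases xs; cases "tl xs") auto
    have R: "R (xs ! i) (xs ! Suc i)" if "Suc i < length xs" for i
      using xs(5) that by (simp add: successively_conv_nth)
    have set: "set xs \<subseteq> nodes T - {s}"
    proof
      fix y assume "y \<in> set xs"
      then obtain i where i: "i < length xs" "y = xs ! i" by (auto simp: in_set_conv_nth)
      show "y \<in> nodes T - {s}"
      proof (cases "i = 0")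
        case True
        then have "y = t" using xs i by (simp add: hd_conv_nth)
        then show ?thesis using C by auto
      next
        case False
        then show ?thesis using R[of "i - 1"] i nT by (auto simp: R_def)
      qed
    qed
    have "graph_cycle T (s # xs)"
      unfolding graph_cycle_def
    proof (intro conjI allI impI)
      fix i assume i: "i < length (s # xs)"
      consider "i = 0" | "i = length xs" | k where "i = Suc k" "Suc k < length xs"
        using i by (cases i) (auto, linarith)
      then show "adj T ((s # xs) ! i) ((s # xs) ! (Suc i mod length (s # xs)))"
      proof cases
        case 1
        then show ?thesis using xs st len by (simp add: hd_conv_nth)
      next
        case 2
        then have "(s # xs) ! i = c" using xs len by (simp add: last_conv_nth nth_Cons')
        then show ?thesis using 2 c(2) by (simp add: adj_sym)
      next
        case 3
        then show ?thesis using R[of k] by (simp add: R_def)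
      qed
    qed (use len xs set st nT in auto)
    with T'(2) show False by blast
  qed
qed

text \<open>Nonsingularity of the \<open>k\<close> by \<open>k\<close> block of \<open>Z\<close> between the copies of \<open>K\<^sub>k\<close> at \<open>s\<close> and \<open>t\<close>.\<close>

definition block_injective :: "nat \<Rightarrow> ('a \<times> nat \<Rightarrow> 'a \<times> nat \<Rightarrow> real) \<Rightarrow> 'a \<Rightarrow> 'a \<Rightarrow> bool" where
  "block_injective k Z s t \<longleftrightarrow>
     (\<forall>x. (\<forall>r<k. (\<Sum>r'<k. Z (s, r) (t, r') * x r') = 0) \<longrightarrow> (\<forall>r<k. x r = 0))"

text \<open>Cut \<open>x\<close> along the branch \<open>C\<close> of \<open>T - s\<close> at \<open>t\<close>. The branch touches the rest of the tree only at
  \<open>s\<close>, where \<open>x\<close> vanishes, so the quadratic form splits into two nonnegative parts with sum zero, and the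
  restriction of \<open>x\<close> to the branch lies in the kernel of \<open>Z\<close> as well. The rows of \<open>Z\<close> at \<open>s\<close> see
  only the block at \<open>t\<close> of this restriction, and that block is nonsingular.\<close>

lemma kernel_spreads_along_edge:
  assumes T: "graph_tree T" and Z: "psd_on (nodes T \<times> {..<k}) Z"
    and supp: "\<And>s r t r'. s \<noteq> t \<Longrightarrow> \<not> adj T s t \<Longrightarrow> Z (s, r) (t, r') = 0"
    and inj: "block_injective k Z s t" and st: "adj T s t"
    and x: "quad (nodes T \<times> {..<k}) Z x = 0" and xs: "\<forall>r<k. x (s, r) = 0"
  shows "\<forall>r<k. x (t, r) = 0"
proof -
  let ?V = "nodes T \<times> {..<k}"
  have sT: "simple_graph T" using T by (simp add: graph_tree_def)
  have V: "finite ?V" using sT by (simp add: simple_graph_def)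
  note nT = adj_nodes[OF sT st]
  obtain C where C: "C \<subseteq> nodes T" "t \<in> C" "s \<notin> C"
    and cl: "\<And>c d. c \<in> C \<Longrightarrow> adj T c d \<Longrightarrow> d \<in> C \<or> d = s"
    and u: "\<And>c. c \<in> C \<Longrightarrow> adj T s c \<Longrightarrow> c = t"
    using tree_branch[OF T st] by blast
  define y where "y p = (if fst p \<in> C then x p else 0)" for p
  define z where "z p = (if fst p \<in> C then 0 else x p)" for p
  have cross: "Z p q * (x p * x q) = 0" if "p \<in> ?V" "q \<in> ?V" "fst p \<in> C" "fst q \<notin> C" for p q
  proof -
    obtain a r b r' where pq: "p = (a, r)" "q = (b, r')" by (metis surj_pair)
    show ?thesis
    proof (cases "adj T a b")
      case True
      then have "b = s" using cl that pq by auto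
      then show ?thesis using xs that pq by simp
    next
      case False
      then have "Z p q = 0" using supp[of a b r r'] that(3,4) pq by auto
      then show ?thesis by simp
    qed
  qed
  have "quad ?V Z x = quad ?V Z y + quad ?V Z z"
    unfolding pairing_def sum.distrib[symmetric]
  proof (intro sum.cong refl)
    fix p q assume pq: "p \<in> ?V" "q \<in> ?V"
    then have "Z p q = Z q p" using psd_on_sym[OF Z] by blast
    then show "Z p q * (x p * x q) = Z p q * (y p * y q) + Z p q * (z p * z q)"
      using cross[of p q] cross[of q p] pq by (auto simp: y_def z_def mult.commute)
  qed
  then have "quad ?V Z y = 0"
    using x psd_on_quad[OF Z, of y] psd_on_quad[OF Z, of z] by linarith
  have "(\<Sum>r'<k. Z (s, r) (t, r') * x (t, r')) = 0" if "r < k" for r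
  proof -
    have "0 = (\<Sum>q\<in>?V. Z (s, r) q * y q)"
      using psd_on_kernel[OF V Z \<open>quad ?V Z y = 0\<close>, of "(s, r)"] nT that by simp
    also have "\<dots> = (\<Sum>q\<in>{t} \<times> {..<k}. Z (s, r) q * y q)"
    proof (rule sum.mono_neutral_right[OF V])
      show "\<forall>q\<in>?V - {t} \<times> {..<k}. Z (s, r) q * y q = 0"
      proof
        fix q assume q: "q \<in> ?V - {t} \<times> {..<k}"
        obtain c r' where c: "q = (c, r')" by (cases q)
        show "Z (s, r) q * y q = 0"
        proof (cases "c \<in> C")
          case True
          then have "c \<noteq> s" "\<not> adj T s c" using C u[of c] q c by auto
          then have "Z (s, r) q = 0" using supp[of s c r r'] c by simp
          then show ?thesis by simp
        qed (simp add: y_def c)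
      qed
    qed (use nT in auto)
    also have "\<dots> = (\<Sum>r'<k. Z (s, r) (t, r') * x (t, r'))"
      using C by (intro sum.reindex_bij_witness[of _ "Pair t" snd]) (auto simp: y_def)
    finally show ?thesis by simp
  qed
  then show ?thesis using inj[unfolded block_injective_def, THEN spec, of "\<lambda>r. x (t, r)"] by blast
qed

lemma kernel_determined_by_root:
  assumes T: "graph_tree T" and Z: "psd_on (nodes T \<times> {..<k}) Z"
    and supp: "\<And>s r t r'. s \<noteq> t \<Longrightarrow> \<not> adj T s t \<Longrightarrow> Z (s, r) (t, r') = 0"
    and inj: "\<And>s t. adj T s t \<Longrightarrow> block_injective k Z s t"
    and x: "quad (nodes T \<times> {..<k}) Z x = 0"
    and root: "v \<in> nodes T" "\<forall>r<k. x (v, r) = 0"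
    and p: "p \<in> nodes T \<times> {..<k}"
  shows "x p = 0"
proof -
  have "(adj T)\<^sup>*\<^sup>* v (fst p)"
    using T root(1) p by (auto simp: graph_tree_def connected_graph_def)
  then have "\<forall>r<k. x (fst p, r) = 0"
  proof (induction rule: rtranclp_induct)
    case (step y z)
    then show ?case using kernel_spreads_along_edge[OF T Z supp inj _ x] by blast
  qed (use root in auto)
  then show ?thesis using p by auto
qed

text \<open>The kernel of the stress has dimension at most \<open>k\<close>, because its elements are determined by
  their values on the copy of \<open>K\<^sub>k\<close> at one node \<open>v\<close>. To obtain a Gram representation from this
  directly, eliminate these \<open>k\<close> indices from an optimal \<open>X\<close>. The remainder \<open>Y\<close> is orthogonal to the
  stress by complementary slackness, so its Gram coordinates are kernel vectors that vanish at \<open>v\<close>,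
  hence vanish everywhere.\<close>

lemma gram_from_root:
  assumes T: "graph_tree T"
    and A: "\<And>i j. A i j = A j i" "\<And>s r t r'. s \<noteq> t \<Longrightarrow> \<not> adj T s t \<Longrightarrow> A (s, r) (t, r') = 0"
    and inj: "\<And>s t. adj T s t \<Longrightarrow> block_injective k A s t"
  shows "\<exists>g. gram_maximal k (nodes T \<times> {..<k}) A g"
proof -
  let ?V = "nodes T \<times> {..<k}"
  have sT: "simple_graph T" "nodes T \<noteq> {}"
    using T by (auto simp: graph_tree_def connected_graph_def)
  have V: "finite ?V" using sT by (simp add: simple_graph_def)
  obtain v where v: "v \<in> nodes T" using sT by blast
  obtain h where h: "gram_maximal (card ?V) ?V A h" using ex_gram_maximal[OF V] by blast
  define X where "X = gram (card ?V) h"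
  have X: "correlation ?V X" and max: "\<And>Y. correlation ?V Y \<Longrightarrow> pairing ?V A Y \<le> pairing ?V A X"
    using h by (auto simp: gram_maximal_def X_def)
  define Z where "Z = stress ?V A X"
  have Z: "psd_on ?V Z" unfolding Z_def by (rule stress_psd[OF V A(1) X max])
  have suppZ: "Z (s, r) (t, r') = 0" if "s \<noteq> t" "\<not> adj T s t" for s r t r'
    using A(2)[OF that] that by (simp add: Z_def stress_def)
  have injZ: "block_injective k Z s t" if "adj T s t" for s t
  proof -
    have "s \<noteq> t" using adj_nodes[OF sT(1) that] by blast
    then have "(\<Sum>r'<k. Z (s, r) (t, r') * x r') = - (\<Sum>r'<k. A (s, r) (t, r') * x r')" for r x
      by (simp add: Z_def stress_def sum_negf)
    then show ?thesis using inj[OF that] by (simp add: block_injective_def)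
  qed
  have "pairing ?V Z X = 0"
    unfolding Z_def pairing_stress[OF V] right_minus_eq
    by (rule pairing_cong) (use X in \<open>auto simp: correlation_def\<close>)
  have card: "card ({v} \<times> {..<k}) = k" by simp
  obtain g Y where Y: "psd_on ?V Y" "\<forall>i\<in>{v} \<times> {..<k}. Y i i = 0"
    and XY: "\<forall>i\<in>?V. \<forall>j\<in>?V. X i j = gram k g i j + Y i j"
  proof -
    have "psd_on ?V X" "{v} \<times> {..<k} \<subseteq> ?V" using X v by (auto simp: correlation_def)
    from partial_cholesky[OF V this] show ?thesis unfolding card using that by blast
  qed
  have "pairing ?V Z X = pairing ?V Z (gram k g) + pairing ?V Z Y"
    unfolding pairing_def sum.distrib[symmetric]
    by (intro sum.cong refl) (simp add: XY algebra_simps)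
  then have ZY: "pairing ?V Z Y = 0"
    using \<open>pairing ?V Z X = 0\<close> psd_pairing_nonneg[OF V Z Y(1)]
      psd_pairing_nonneg[OF V Z psd_on_gram[of ?V k g]] by linarith
  obtain f where f: "\<And>i j. i \<in> ?V \<Longrightarrow> j \<in> ?V \<Longrightarrow> Y i j = gram (card ?V) f i j"
    by (rule psd_on_imp_gram[OF V Y(1)]) (rule that)
  have "pairing ?V Z (gram (card ?V) f) = 0"
    using ZY pairing_cong[of ?V Z Y Z "gram (card ?V) f"] f by simp
  then have quad0: "quad ?V Z (\<lambda>i. f i c) = 0" if "c < card ?V" for c
    unfolding pairing_gram using that
    by (subst (asm) sum_nonneg_eq_0_iff) (auto intro: psd_on_quad[OF Z])
  have root0: "f (v, r) c = 0" if "r < k" "c < card ?V" for r c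
  proof -
    have "gram (card ?V) f (v, r) (v, r) = 0" using f[of "(v, r)" "(v, r)"] Y(2) v that by simp
    then have "\<forall>c<card ?V. f (v, r) c * f (v, r) c = 0"
      unfolding gram_def by (subst (asm) sum_nonneg_eq_0_iff) auto
    then show ?thesis using that by simp
  qed
  have "f p c = 0" if "p \<in> ?V" "c < card ?V" for p c
    using kernel_determined_by_root[OF T Z suppZ injZ quad0[OF that(2)] v _ that(1)] root0 that by blast
  then have Y0: "Y i j = 0" if "i \<in> ?V" "j \<in> ?V" for i j
    using f[OF that] that by (simp add: gram_def)
  have eq: "X i j = gram k g i j" if "i \<in> ?V" "j \<in> ?V" for i j
    using XY[rule_format, OF that] Y0[OF that] by simp
  have "correlation ?V (gram k g)"
    using X correlation_cong[of ?V X "gram k g"] eq by blast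
  moreover have "pairing ?V A X = pairing ?V A (gram k g)"
    by (rule pairing_cong) (simp add: eq)
  ultimately have "gram_maximal k ?V A g" using max by (simp add: gram_maximal_def)
  then show ?thesis by blast
qed

section \<open>Generic weights on products with trees\<close>

text \<open>Diagonal weights only add a constant to the objective on correlation kernels. Admitting them
  lets equal and adjacent pairs be treated alike when weights are lifted along a contraction.\<close>

definition weight_on :: "'a sgraph \<Rightarrow> ('a \<Rightarrow> 'a \<Rightarrow> real) \<Rightarrow> bool" where
  "weight_on G A \<longleftrightarrow> (\<forall>i j. A i j = A j i) \<and> (\<forall>i j. A i j \<noteq> 0 \<longrightarrow> i = j \<or> adj G i j)"

text \<open>For a graph whose nodes form an index type this says that the extreme Gram dimension is at
  most \<open>k\<close> (for \<open>k \<ge> 1\<close>); it makes sense for the graphs on other types that occur as intermediate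
  minors.\<close>

definition low_rank_optima :: "nat \<Rightarrow> 'a sgraph \<Rightarrow> bool" where
  "low_rank_optima k G \<longleftrightarrow> (\<forall>A. weight_on G A \<longrightarrow> (\<exists>g. gram_maximal k (nodes G) A g))"

lemma gram_maximal_limit:
  assumes V: "finite V" and g: "\<And>m. gram_maximal k V (A m) (g m)"
    and A: "\<And>i j. i \<in> V \<Longrightarrow> j \<in> V \<Longrightarrow> (\<lambda>m. A m i j) \<longlonglongrightarrow> B i j"
  shows "\<exists>h. gram_maximal k V B h"
proof -
  obtain h r where r: "strict_mono r" and h: "correlation V (gram k h)"
    and lim: "\<And>i j. i \<in> V \<Longrightarrow> j \<in> V \<Longrightarrow> (\<lambda>m. gram k (g (r m)) i j) \<longlonglongrightarrow> gram k h i j"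
    by (rule gram_compactness[OF V, where g = g and d = k]) (use g in \<open>auto simp: gram_maximal_def\<close>)
  have Ar: "(\<lambda>m. A (r m) i j) \<longlonglongrightarrow> B i j" if "i \<in> V" "j \<in> V" for i j
    using LIMSEQ_subseq_LIMSEQ[OF A[OF that] r] by (simp add: o_def)
  have "pairing V B X \<le> pairing V B (gram k h)" if X: "correlation V X" for X
  proof (rule LIMSEQ_le)
    show "(\<lambda>m. pairing V (A (r m)) X) \<longlonglongrightarrow> pairing V B X"
      by (intro pairing_tendsto Ar tendsto_const)
    show "(\<lambda>m. pairing V (A (r m)) (gram k (g (r m)))) \<longlonglongrightarrow> pairing V B (gram k h)"
      by (intro pairing_tendsto Ar lim)
    show "\<exists>N. \<forall>m\<ge>N. pairing V (A (r m)) X \<le> pairing V (A (r m)) (gram k (g (r m)))"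
      using g X by (auto simp: gram_maximal_def)
  qed
  then show ?thesis using h by (auto simp: gram_maximal_def)
qed

text \<open>A shift \<open>e\<close> in this set is the negative of an eigenvalue of \<open>M\<close>.\<close>

lemma finite_singular_shifts:
  fixes M :: "nat \<Rightarrow> nat \<Rightarrow> real"
  shows "finite {e. \<exists>x. (\<forall>r<k. (\<Sum>r'<k. M r r' * x r') + e * x r = 0) \<and> (\<exists>r<k. x r \<noteq> 0)}"
    (is "finite ?S")
proof -
  let ?A = "mat k k (\<lambda>(r, r'). M r r')"
  have A: "?A \<in> carrier_mat k k" by simp
  have "poly (char_poly ?A) (- e) = 0" if "e \<in> ?S" for e
  proof -
    from that obtain x where x: "\<forall>r<k. (\<Sum>r'<k. M r r' * x r') + e * x r = 0" "\<exists>r<k. x r \<noteq> 0" by blast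
    have "eigenvector ?A (vec k x) (- e)"
      unfolding eigenvector_def
    proof (intro conjI)
      show "vec k x \<in> carrier_vec (dim_row ?A)" by simp
      show "vec k x \<noteq> 0\<^sub>v (dim_row ?A)"
      proof
        assume eq: "vec k x = 0\<^sub>v (dim_row ?A)"
        have "x r = 0" if "r < k" for r
          using arg_cong[OF eq, of "\<lambda>v. vec_index v r"] that by simp
        then show False using x(2) by blast
      qed
      show "?A *\<^sub>v vec k x = (- e) \<cdot>\<^sub>v vec k x"
      proof (rule eq_vecI)
        fix r assume "r < dim_vec ((- e) \<cdot>\<^sub>v vec k x)"
        then have r: "r < k" by simp
        have "vec_index (?A *\<^sub>v vec k x) r = (\<Sum>r'<k. M r r' * x r')"
          using r by (simp add: scalar_prod_def atLeast0LessThan)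
        also have "\<dots> = - e * x r" using x(1) r by (simp add: add_eq_0_iff)
        also have "\<dots> = vec_index ((- e) \<cdot>\<^sub>v vec k x) r" using r by simp
        finally show "vec_index (?A *\<^sub>v vec k x) r = vec_index ((- e) \<cdot>\<^sub>v vec k x) r" .
      qed simp
    qed
    then show ?thesis using eigenvalue_root_char_poly[OF A] by (auto simp: eigenvalue_def)
  qed
  then have "?S \<subseteq> uminus ` {z. poly (char_poly ?A) z = 0}"
    by (metis (mono_tags, lifting) image_eqI mem_Collect_eq minus_minus subsetI)
  moreover have "char_poly ?A \<noteq> 0" using degree_monic_char_poly[OF A] by auto
  ultimately show ?thesis using poly_roots_finite finite_surj by blast
qed

lemma nodes_product_complete: "nodes (T \<boxtimes> complete_graph k) = nodes T \<times> {..<k}"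
  by (simp add: strong_product_def complete_graph_def)

lemma adj_strong_product:
  "adj (G \<boxtimes> H) (i, i') (j, j') \<longleftrightarrow> {i, j} \<subseteq> nodes G \<and> {i', j'} \<subseteq> nodes H \<and>
    (i, i') \<noteq> (j, j') \<and> (i = j \<or> adj G i j) \<and> (i' = j' \<or> adj H i' j')"
  by (auto simp: adj_def strong_product_def doubleton_eq_iff insert_commute)

lemma adj_complete_graph: "adj (complete_graph k) a b \<longleftrightarrow> a < k \<and> b < k \<and> a \<noteq> b"
  by (auto simp: adj_def complete_graph_def)

text \<open>The blocks of \<open>A\<close> along the edges of \<open>T\<close> may be singular, but adding \<open>e\<close> times the identity to
  each of them repairs this for all but finitely many \<open>e\<close>. The added entries lie on edges of
  \<open>T \<boxtimes> K\<^sub>k\<close>, and the maximisers for \<open>e \<rightarrow> 0\<close> accumulate at one for \<open>A\<close>.\<close>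

lemma low_rank_optima_tree_product:
  assumes T: "graph_tree T"
  shows "low_rank_optima k (T \<boxtimes> complete_graph k)"
  unfolding low_rank_optima_def
proof (intro allI impI)
  fix A assume w: "weight_on (T \<boxtimes> complete_graph k) A"
  let ?V = "nodes T \<times> {..<k}"
  have sT: "simple_graph T" using T by (simp add: graph_tree_def)
  have fT: "finite (nodes T)" using sT by (simp add: simple_graph_def)
  have A1: "A i j = A j i" for i j
    using w unfolding weight_on_def by blast
  have A2: "A (s, r) (t, r') = 0" if "s \<noteq> t" "\<not> adj T s t" for s t r r'
  proof (rule ccontr)
    assume "A (s, r) (t, r') \<noteq> 0"
    then have "(s, r) = (t, r') \<or> adj (T \<boxtimes> complete_graph k) (s, r) (t, r')"
      using w unfolding weight_on_def by blast
    then show False using that by (simp add: adj_strong_product)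
  qed
  define bad where "bad s t = {e. \<exists>x. (\<forall>r<k. (\<Sum>r'<k. A (s, r) (t, r') * x r') + e * x r = 0) \<and> (\<exists>r<k. x r \<noteq> 0)}"
    for s t
  define N :: "'a \<times> nat \<Rightarrow> 'a \<times> nat \<Rightarrow> real" where
    "N p q = of_bool (adj T (fst p) (fst q) \<and> snd p = snd q)" for p q
  have fin: "finite (\<Union>s\<in>nodes T. \<Union>t\<in>nodes T. bad s t)"
    using fT finite_singular_shifts by (auto simp: bad_def)
  have "\<exists>e. 0 < e \<and> e < 1 / real (Suc m) \<and> e \<notin> (\<Union>s\<in>nodes T. \<Union>t\<in>nodes T. bad s t)" for m
  proof -
    have "infinite {0<..<1 / real (Suc m)}" by (rule infinite_Ioo) simp
    from infinite_imp_nonempty[OF Diff_infinite_finite[OF fin this]] show ?thesis by auto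
  qed
  then obtain e where e: "\<And>m. 0 < e m" "\<And>m. e m < 1 / real (Suc m)"
    "\<And>m. e m \<notin> (\<Union>s\<in>nodes T. \<Union>t\<in>nodes T. bad s t)" by metis
  have "\<exists>g. gram_maximal k ?V (\<lambda>p q. A p q + e m * N p q) g" for m
  proof (rule gram_from_root[OF T])
    show "A i j + e m * N i j = A j i + e m * N j i" for i j
      using A1[of i j] adj_sym[of T] by (auto simp: N_def)
    show "A (s, r) (t, r') + e m * N (s, r) (t, r') = 0" if "s \<noteq> t" "\<not> adj T s t" for s r t r'
      using A2[OF that] that by (simp add: N_def)
    show "block_injective k (\<lambda>p q. A p q + e m * N p q) s t" if st: "adj T s t" for s t
    proof -
      have "(\<Sum>r'<k. (A (s, r) (t, r') + e m * N (s, r) (t, r')) * x r')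
          = (\<Sum>r'<k. A (s, r) (t, r') * x r') + e m * x r" if "r < k" for r x
      proof -
        have "(\<Sum>r'<k. (A (s, r) (t, r') + e m * N (s, r) (t, r')) * x r')
          = (\<Sum>r'<k. A (s, r) (t, r') * x r' + (if r = r' then e m * x r' else 0))"
          using st by (intro sum.cong refl) (simp add: N_def algebra_simps)
        then show ?thesis using that by (simp add: sum.distrib)
      qed
      moreover have "e m \<notin> bad s t" using e(3) adj_nodes[OF sT st] by blast
      ultimately show ?thesis by (auto simp: block_injective_def bad_def)
    qed
  qed
  then have "\<forall>m. \<exists>g. gram_maximal k ?V (\<lambda>p q. A p q + e m * N p q) g" by blast
  from choice[OF this] obtain g where "\<forall>m. gram_maximal k ?V (\<lambda>p q. A p q + e m * N p q) (g m)" ..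
  then have g: "gram_maximal k ?V (\<lambda>p q. A p q + e m * N p q) (g m)" for m by (rule spec)
  have "e \<longlonglongrightarrow> 0"
    by (rule tendsto_sandwich[OF _ _ tendsto_const LIMSEQ_Suc[OF lim_const_over_n[of 1]]])
       (auto intro!: always_eventually less_imp_le e simp del: of_nat_Suc)
  then have "(\<lambda>m. A i j + e m * N i j) \<longlonglongrightarrow> A i j + 0 * N i j" for i j
    by (intro tendsto_intros)
  then have "\<exists>h. gram_maximal k ?V A h"
    using fT by (intro gram_maximal_limit[OF _ g]) auto
  then show "\<exists>g. gram_maximal k (nodes (T \<boxtimes> complete_graph k)) A g"
    by (simp add: nodes_product_complete)
qed

section \<open>Minors\<close>

text \<open>This covers the deletion of edges and nodes as well as isomorphisms. A weight on \<open>H\<close> is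
  extended by zero; a competitor on \<open>H\<close> is extended by repeating one of its vectors on the new nodes,
  which do not contribute to the objective.\<close>

lemma low_rank_optima_embedding:
  assumes G: "low_rank_optima k G" "finite (nodes G)"
    and inj: "inj_on f (nodes H)" and img: "f ` nodes H \<subseteq> nodes G"
    and adj: "\<And>i j. i \<in> nodes H \<Longrightarrow> j \<in> nodes H \<Longrightarrow> adj H i j \<Longrightarrow> adj G (f i) (f j)"
  shows "low_rank_optima k H"
  unfolding low_rank_optima_def
proof (intro allI impI)
  fix A assume w: "weight_on H A"
  let ?W = "nodes H" and ?V = "nodes G" and ?f' = "inv_into (nodes H) f"
  have W: "finite ?W" using inj img G(2) finite_subset finite_imageD by blast
  show "\<exists>g. gram_maximal k ?W A g"
  proof (cases "?W = {}")
    case True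
    then show ?thesis by (simp add: gram_maximal_def correlation_def psd_on_def pairing_def)
  next
    case False
    then obtain a where a: "a \<in> ?W" by blast
    define B where "B i j = (if i \<in> f ` ?W \<and> j \<in> f ` ?W then A (?f' i) (?f' j) else 0)" for i j
    have "weight_on G B"
      unfolding weight_on_def
    proof (intro conjI allI impI)
      show "B i j = B j i" for i j using w by (simp add: B_def weight_on_def)
      show "i = j \<or> adj G i j" if "B i j \<noteq> 0" for i j
      proof -
        from that obtain a b where ab: "i = f a" "j = f b" "a \<in> ?W" "b \<in> ?W"
          by (auto simp: B_def split: if_splits)
        then have "A a b \<noteq> 0" using that inj by (simp add: B_def)
        then have "a = b \<or> adj H a b" using w unfolding weight_on_def by blast
        then show ?thesis using adj ab by auto
      qed
    qed
    then obtain g where g: "gram_maximal k ?V B g" using G(1) by (auto simp: low_rank_optima_def)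
    have pull: "pairing ?V B X = pairing ?W A (\<lambda>i j. X (f i) (f j))" for X
    proof -
      have "pairing ?V B X = pairing (f ` ?W) B X"
        unfolding pairing_def
        apply (rule sum.mono_neutral_cong_right[OF G(2) img])
         apply (simp add: B_def)
        apply (rule sum.mono_neutral_right[OF G(2) img])
        apply (simp add: B_def)
        done
      also have "\<dots> = pairing ?W A (\<lambda>i j. X (f i) (f j))"
        unfolding pairing_def using inj
        by (simp add: sum.reindex B_def)
      finally show ?thesis .
    qed
    have eq: "(\<lambda>i j. gram k g (f i) (f j)) = gram k (\<lambda>i. g (f i))"
      by (simp add: gram_def fun_eq_iff)
    have "correlation ?W (gram k (\<lambda>i. g (f i)))"
      using correlation_pullback[OF G(2) _ img, of "gram k g"] g
      by (simp add: gram_maximal_def eq)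
    moreover have "pairing ?W A X \<le> pairing ?W A (gram k (\<lambda>i. g (f i)))" if X: "correlation ?W X" for X
    proof -
      \<comment> \<open>Nodes outside the image repeat the vector of \<open>a\<close>.\<close>
      define h where "h i = (if i \<in> f ` ?W then ?f' i else a)" for i
      have "h ` ?V \<subseteq> ?W" using a by (auto simp: h_def inj)
      then have "correlation ?V (\<lambda>i j. X (h i) (h j))" by (rule correlation_pullback[OF W X])
      then have "pairing ?V B (\<lambda>i j. X (h i) (h j)) \<le> pairing ?V B (gram k g)"
        using g by (simp add: gram_maximal_def)
      moreover have "pairing ?V B (\<lambda>i j. X (h i) (h j)) = pairing ?W A X"
        unfolding pull by (rule pairing_cong) (simp add: h_def inj)
      ultimately show ?thesis by (simp add: pull eq)
    qed
    ultimately show ?thesis by (auto simp: gram_maximal_def)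
  qed
qed

lemma simple_graph_contract_edge:
  "simple_graph G \<Longrightarrow> simple_graph (contract_edge u v G)"
  by (auto simp: simple_graph_def contract_edge_def Let_def)

lemma adj_contract_edge:
  fixes u v :: 'a
  defines "f \<equiv> \<lambda>x. if x = v then u else x"
  assumes G: "simple_graph G" and ab: "adj (contract_edge u v G) a b"
  shows "\<exists>i j. adj G i j \<and> f i = a \<and> f j = b"
proof -
  obtain e where e: "e \<in> edges G" "{a, b} = f ` e"
    using ab by (auto simp: adj_def contract_edge_def Let_def f_def)
  then obtain i j where ij: "e = {i, j}"
    using G by (auto simp: simple_graph_def card_2_iff)
  then have "adj G i j" "adj G j i" using e by (auto simp: adj_def insert_commute)
  moreover have "f i = a \<and> f j = b \<or> f j = a \<and> f i = b"
    using e ij by (auto simp: doubleton_eq_iff)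
  ultimately show ?thesis by blast
qed

text \<open>The weight of a pair in the contracted graph is distributed evenly over the pairs of \<open>G\<close> that are
  mapped to it; there is at least one whenever the weight is nonzero.\<close>

lemma contraction_lift:
  fixes u v :: 'a
  defines "f \<equiv> \<lambda>x. if x = v then u else x"
  assumes G: "simple_graph G" and w: "weight_on (contract_edge u v G) A"
  obtains B where "weight_on G B"
    "\<And>Y. pairing (nodes G) B (\<lambda>i j. Y (f i) (f j)) = pairing (nodes (contract_edge u v G)) A Y"
proof -
  let ?V = "nodes G" and ?W = "nodes (contract_edge u v G)"
  have V: "finite ?V" using G by (simp add: simple_graph_def)
  have W: "?W = f ` ?V" by (simp add: contract_edge_def Let_def f_def)
  define P where "P = {p \<in> ?V \<times> ?V. fst p = snd p \<or> adj G (fst p) (snd p)}"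
  define F where "F = map_prod f f"
  define N where "N q = card {p \<in> P. F p = q}" for q
  define B where "B i j = (if (i, j) \<in> P then A (f i) (f j) / real (N (f i, f j)) else 0)" for i j
  have P: "finite P" using V by (simp add: P_def)
  have symP: "(i, j) \<in> P \<longleftrightarrow> (j, i) \<in> P" for i j using adj_sym[of G] by (auto simp: P_def)
  have symN: "N (a, b) = N (b, a)" for a b
  proof -
    have "bij_betw prod.swap {p \<in> P. F p = (a, b)} {p \<in> P. F p = (b, a)}"
      using symP by (intro bij_betwI[of _ _ _ prod.swap]) (auto simp: F_def)
    then show ?thesis unfolding N_def by (rule bij_betw_same_card)
  qed
  have wA: "A a b = A b a" "A a b \<noteq> 0 \<Longrightarrow> a = b \<or> adj (contract_edge u v G) a b" for a b
    using w unfolding weight_on_def by blast+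
  have wB: "weight_on G B"
    unfolding weight_on_def
  proof (intro conjI allI impI)
    show "B i j = B j i" for i j
      using symP[of i j] symN[of "f i" "f j"] wA(1)[of "f i" "f j"] by (simp add: B_def)
    show "i = j \<or> adj G i j" if "B i j \<noteq> 0" for i j
      using that by (auto simp: B_def P_def split: if_splits)
  qed
  have N0: "A a b = 0" if ab: "a \<in> ?W" "b \<in> ?W" "N (a, b) = 0" for a b
  proof (rule ccontr)
    assume "A a b \<noteq> 0"
    then consider "a = b" | "adj (contract_edge u v G) a b" using wA by blast
    then have "\<exists>p\<in>P. F p = (a, b)"
    proof cases
      case 1
      then obtain i where "i \<in> ?V" "f i = a" using ab(1) W by auto
      then show ?thesis using 1 by (intro bexI[of _ "(i, i)"]) (auto simp: P_def F_def)
    next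
      case 2
      then obtain i j where "adj G i j" "f i = a" "f j = b"
        using adj_contract_edge[OF G 2] unfolding f_def by blast
      then show ?thesis using adj_nodes[OF G]
        by (intro bexI[of _ "(i, j)"]) (auto simp: P_def F_def)
    qed
    then show False using ab(3) P by (auto simp: N_def)
  qed
  have "pairing ?V B (\<lambda>i j. Y (f i) (f j)) = pairing ?W A Y" for Y
  proof -
    define h where "h q = A (fst q) (snd q) * Y (fst q) (snd q)" for q
    have "pairing ?V B (\<lambda>i j. Y (f i) (f j)) = (\<Sum>p\<in>?V \<times> ?V. if p \<in> P then h (F p) / real (N (F p)) else 0)"
      unfolding pairing_def sum.cartesian_product
      by (intro sum.cong refl) (auto simp: B_def h_def F_def)
    also have "\<dots> = (\<Sum>p\<in>P. h (F p) / real (N (F p)))"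
      using V by (intro sum.mono_neutral_cong_right) (auto simp: P_def)
    also have "\<dots> = (\<Sum>q\<in>?W \<times> ?W. \<Sum>p\<in>{p \<in> P. F p = q}. h (F p) / real (N (F p)))"
      using V P by (intro sum.group[symmetric]) (auto simp: W P_def F_def)
    also have "\<dots> = (\<Sum>q\<in>?W \<times> ?W. real (N q) * (h q / real (N q)))"
      by (intro sum.cong refl) (simp add: N_def)
    also have "\<dots> = (\<Sum>q\<in>?W \<times> ?W. h q)"
      using N0 by (intro sum.cong refl) (auto simp: h_def)
    also have "\<dots> = pairing ?W A Y"
      unfolding pairing_def sum.cartesian_product by (intro sum.cong refl) (auto simp: h_def)
    finally show ?thesis .
  qed
  with wB show ?thesis using that by blast
qed

text \<open>A weight \<open>m \<rightarrow> \<infinity>\<close> on the edge \<open>uv\<close> forces the vectors of \<open>u\<close> and \<open>v\<close> together. Competitors with equal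
  vectors at \<open>u\<close> and \<open>v\<close> collect the full bonus \<open>2 * m\<close> (the edge counts in both orders), so the maximisers
  must have \<open>1 - X u v\<close> of order \<open>1 / m\<close>. In a limit of them the two vectors agree, and it is a maximiser
  for the contracted graph.\<close>

lemma low_rank_optima_contract_edge:
  fixes G :: "'a sgraph"
  assumes G: "simple_graph G" and lr: "low_rank_optima k G" and uv: "adj G u v"
  shows "low_rank_optima k (contract_edge u v G)"
  unfolding low_rank_optima_def
proof (intro allI impI)
  fix A assume w: "weight_on (contract_edge u v G) A"
  define f where "f = (\<lambda>x. if x = v then u else x)"
  let ?V = "nodes G" and ?W = "nodes (contract_edge u v G)"
  have V: "finite ?V" using G by (simp add: simple_graph_def)
  have W: "?W = f ` ?V" by (simp add: contract_edge_def Let_def f_def)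
  note uvV = adj_nodes[OF G uv]
  have WV: "?W \<subseteq> ?V" using uvV by (auto simp: W f_def)
  obtain B where wB: "weight_on G B"
    and B: "\<And>Y. pairing ?V B (\<lambda>i j. Y (f i) (f j)) = pairing ?W A Y"
    using contraction_lift[OF G w] unfolding f_def by blast
  define J :: "'a \<Rightarrow> 'a \<Rightarrow> real" where "J i j = of_bool (i = u \<and> j = v \<or> i = v \<and> j = u)" for i j
  \<comment> \<open>\<open>J\<close> is the adjacency kernel of the edge to be contracted.\<close>
  define C where "C m i j = B i j + real m * J i j" for m i j
  have C: "pairing ?V (C m) X = pairing ?V B X + 2 * real m * X u v"
    if X: "correlation ?V X" for m X
  proof -
    have "pairing ?V (C m) X = (\<Sum>i\<in>?V. \<Sum>j\<in>?V. B i j * X i j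
        + (if j = v then (if i = u then real m * X i j else 0) else 0)
        + (if j = u then (if i = v then real m * X i j else 0) else 0))"
      unfolding pairing_def using uvV
      by (intro sum.cong refl) (auto simp: C_def J_def algebra_simps)
    also have "\<dots> = pairing ?V B X + real m * X u v + real m * X v u"
      using uvV V by (simp add: sum.distrib pairing_def)
    also have "X v u = X u v" using X psd_on_sym[of ?V X v u] uvV by (simp add: correlation_def)
    finally show ?thesis by simp
  qed
  have "weight_on G (C m)" for m
    using wB uv adj_sym[OF uv] unfolding weight_on_def C_def J_def
    by (auto split: if_splits)
  then have "\<forall>m. \<exists>g. gram_maximal k ?V (C m) g"
    using lr unfolding low_rank_optima_def by blast
  from choice[OF this] obtain g where "\<forall>m. gram_maximal k ?V (C m) (g m)" ..
  then have g: "gram_maximal k ?V (C m) (g m)" for m by (rule spec)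
  define X where "X m = gram k (g m)" for m
  have X: "correlation ?V (X m)" for m using g[of m] by (simp add: X_def gram_maximal_def)
  have opt: "pairing ?W A Y + 2 * real m * (1 - X m u v) \<le> pairing ?V B (X m)"
    if Y: "correlation ?W Y" for m Y
  proof -
    have finW: "finite ?W" using V WV finite_subset by blast
    have cor: "correlation ?V (\<lambda>i j. Y (f i) (f j))"
      by (rule correlation_pullback[OF finW Y]) (simp add: W)
    then have "pairing ?V (C m) (\<lambda>i j. Y (f i) (f j)) \<le> pairing ?V (C m) (X m)"
      using g[of m] by (simp add: gram_maximal_def X_def)
    then have "pairing ?V B (\<lambda>i j. Y (f i) (f j)) + 2 * real m * Y (f u) (f v)
        \<le> pairing ?V B (X m) + 2 * real m * X m u v"
      unfolding C[OF cor] C[OF X] .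
    moreover have "Y (f u) (f v) = 1"
      using Y uvV W by (auto simp: f_def correlation_def)
    ultimately show ?thesis by (simp add: B algebra_simps)
  qed
  have le1: "X m u v \<le> 1" for m
    using correlation_bound[OF V X uvV(1,2)] by (simp add: abs_le_iff)
  obtain h r where r: "strict_mono r" and h: "correlation ?V (gram k h)"
    and lim: "\<And>i j. i \<in> ?V \<Longrightarrow> j \<in> ?V \<Longrightarrow> (\<lambda>m. gram k (g (r m)) i j) \<longlonglongrightarrow> gram k h i j"
    by (rule gram_compactness[OF V, where g = g and d = k]) (use X in \<open>auto simp: X_def\<close>)
  have hW: "correlation ?W (gram k h)"
    using correlation_pullback[OF V h, of id ?W] WV by simp
  have "gram k h u v = 1"
  proof -
    define K where "K = (\<Sum>i\<in>?V. \<Sum>j\<in>?V. \<bar>B i j\<bar>) - pairing ?W A (gram k h)"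
    have low: "1 - K / real (Suc m) \<le> X (Suc m) u v" for m
    proof -
      have "pairing ?W A (gram k h) + 2 * real (Suc m) * (1 - X (Suc m) u v)
          \<le> (\<Sum>i\<in>?V. \<Sum>j\<in>?V. \<bar>B i j\<bar>)"
        using opt[OF hW, of "Suc m"] pairing_bound[OF V X, of B "Suc m"] by linarith
      moreover have "real (Suc m) * (1 - X (Suc m) u v) \<le> 2 * real (Suc m) * (1 - X (Suc m) u v)"
        using le1[of "Suc m"] by (intro mult_right_mono) auto
      ultimately have "real (Suc m) * (1 - X (Suc m) u v) \<le> K" by (simp add: K_def)
      then show ?thesis by (simp add: field_simps)
    qed
    have "(\<lambda>m. 1 - K * (1 / real (Suc m))) \<longlonglongrightarrow> 1 - K * 0"
      by (intro tendsto_diff tendsto_mult tendsto_const LIMSEQ_Suc[OF lim_const_over_n[of 1]])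
    then have "(\<lambda>m. 1 - K / real (Suc m)) \<longlonglongrightarrow> 1" by simp
    then have "(\<lambda>m. X (Suc m) u v) \<longlonglongrightarrow> 1"
      by (rule tendsto_sandwich[rotated 2, OF _ tendsto_const])
        (auto intro!: always_eventually low le1 simp del: of_nat_Suc)
    then have "(\<lambda>m. X m u v) \<longlonglongrightarrow> 1" by (rule LIMSEQ_imp_Suc)
    from LIMSEQ_subseq_LIMSEQ[OF this r] have "(\<lambda>m. X (r m) u v) \<longlonglongrightarrow> 1"
      by (simp add: o_def)
    then show ?thesis using LIMSEQ_unique lim[OF uvV(1,2)] by (auto simp: X_def)
  qed
  moreover have "gram k h u u = 1" "gram k h v v = 1" using h uvV by (auto simp: correlation_def)
  moreover have "(\<Sum>c<k. (h u c - h v c)\<^sup>2) = gram k h u u + gram k h v v - 2 * gram k h u v"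
    unfolding gram_def sum_distrib_left sum.distrib[symmetric] sum_subtractf[symmetric]
    by (intro sum.cong refl) (simp add: power2_eq_square algebra_simps)
  ultimately have "(\<Sum>c<k. (h u c - h v c)\<^sup>2) = 0" by simp
  then have huv: "h u c = h v c" if "c < k" for c
    using that by (subst (asm) sum_nonneg_eq_0_iff) auto
  have merged: "gram k h i j = gram k h (f i) (f j)" for i j
    unfolding gram_def f_def using huv by (intro sum.cong refl) auto
  have "pairing ?W A Y \<le> pairing ?W A (gram k h)" if Y: "correlation ?W Y" for Y
  proof -
    have "pairing ?W A Y \<le> pairing ?V B (X (r m))" for m
    proof -
      have "0 \<le> 2 * real (r m) * (1 - X (r m) u v)" using le1 by simp
      then show ?thesis using opt[OF Y, of "r m"] by linarith
    qed
    moreover have "(\<lambda>m. pairing ?V B (X (r m))) \<longlonglongrightarrow> pairing ?V B (gram k h)"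
      unfolding X_def by (intro pairing_tendsto lim tendsto_const)
    ultimately have "pairing ?W A Y \<le> pairing ?V B (gram k h)"
      by (intro LIMSEQ_le_const) auto
    also have "\<dots> = pairing ?V B (\<lambda>i j. gram k h (f i) (f j))"
      by (rule pairing_cong) (simp add: merged[symmetric])
    also have "\<dots> = pairing ?W A (gram k h)" by (rule B)
    finally show ?thesis .
  qed
  then have "gram_maximal k ?W A h" using hW by (simp add: gram_maximal_def)
  then show "\<exists>g. gram_maximal k ?W A g" by blast
qed

lemma low_rank_optima_minor_step:
  assumes "minor_step G H" "simple_graph G" "low_rank_optima k G"
  shows "simple_graph H \<and> low_rank_optima k H"
  using assms
proof (induction rule: minor_step.induct)
  case (edge_deletion e G)
  then have "low_rank_optima k (delete_edge e G)"
    by - (rule low_rank_optima_embedding[of k G "\<lambda>x. x"],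
      auto simp: delete_edge_def simple_graph_def adj_def)
  with edge_deletion show ?case by (auto simp: delete_edge_def simple_graph_def)
next
  case (edge_contraction G u v)
  then show ?case
    by (simp add: simple_graph_contract_edge low_rank_optima_contract_edge)
next
  case (node_deletion v G)
  then have "low_rank_optima k (delete_node v G)"
    by - (rule low_rank_optima_embedding[of k G "\<lambda>x. x"],
      auto simp: delete_node_def simple_graph_def adj_def)
  with node_deletion show ?case by (auto simp: delete_node_def simple_graph_def)
qed

lemma simple_graph_strong_product:
  assumes "simple_graph G" "simple_graph H"
  shows "simple_graph (G \<boxtimes> H)"
  using assms by (auto simp: simple_graph_def strong_product_def card_2_iff)

lemma simple_complete_graph: "simple_graph (complete_graph k)"
  by (auto simp: simple_graph_def complete_graph_def)

lemma low_rank_optima_minor: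
  assumes T: "graph_tree T" and G: "graph_minor G (T \<boxtimes> complete_graph k)"
  shows "low_rank_optima k G"
proof -
  obtain H where H: "minor_step\<^sup>*\<^sup>* (T \<boxtimes> complete_graph k) H" "graph_iso G H"
    using G by (auto simp: graph_minor_def)
  have "simple_graph (T \<boxtimes> complete_graph k)"
    using T by (intro simple_graph_strong_product simple_complete_graph) (simp add: graph_tree_def)
  from H(1) this low_rank_optima_tree_product[OF T] have lr: "simple_graph H \<and> low_rank_optima k H"
    by (induction rule: rtranclp_induct) (use low_rank_optima_minor_step in blast)+
  obtain f where f: "bij_betw f (nodes G) (nodes H)"
    "\<And>i j. i \<in> nodes G \<Longrightarrow> j \<in> nodes G \<Longrightarrow> adj G i j \<Longrightarrow> adj H (f i) (f j)"
    using H(2) by (auto simp: graph_iso_def)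
  show ?thesis
    using lr f by - (rule low_rank_optima_embedding[of k H f], auto simp: simple_graph_def bij_betw_def)
qed

section \<open>The semidefinite program\<close>

text \<open>The columns are combinations of the \<open>k\<close> coordinate vectors of \<open>g\<close>.\<close>

lemma rank_gram_le: "rank (\<chi> i j. gram k g i j) \<le> k"
proof -
  let ?M = "(\<chi> i j. gram k g i j) :: real^'a^'a"
  let ?B = "(\<lambda>c. (\<chi> i. g i c) :: real^'a) ` {..<k}"
  have "column j ?M = (\<Sum>c<k. g j c *\<^sub>R (\<chi> i. g i c))" for j
    by (simp add: column_def gram_def Finite_Cartesian_Product.vec_eq_iff mult.commute)
  moreover have "(\<Sum>c<k. g j c *\<^sub>R (\<chi> i. g i c)) \<in> span ?B" for j
    by (intro span_sum span_scale span_base imageI) simp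
  ultimately have "columns ?M \<subseteq> span ?B"
    by (auto simp: columns_def)
  then have "dim (columns ?M) \<le> card ?B" by (rule dim_le_card) simp
  also have "\<dots> \<le> k" using card_image_le[of "{..<k}"] by (metis card_lessThan finite_lessThan)
  finally show ?thesis by (simp add: column_rank_def)
qed

lemma psd_matrix_iff: "psd_matrix M \<longleftrightarrow> psd_on UNIV (\<lambda>i j. vec_nth (vec_nth M i) j)"
proof -
  let ?X = "\<lambda>i j. vec_nth (vec_nth M i) j"
  have q: "inner x (M *v x) = quad UNIV ?X (vec_nth x)" for x
    unfolding pairing_def inner_vec_def matrix_vector_mult_def
    by (simp add: sum_distrib_left mult.assoc mult.left_commute)
  have "(\<forall>x. 0 \<le> inner x (M *v x)) \<longleftrightarrow> (\<forall>x. 0 \<le> quad UNIV ?X x)"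
  proof (intro iffI allI)
    fix x assume "\<forall>x. 0 \<le> inner x (M *v x)"
    from this[THEN spec, of "vec_lambda x"] show "0 \<le> quad UNIV ?X x" unfolding q by simp
  next
    fix x assume "\<forall>x. 0 \<le> quad UNIV ?X x"
    then show "0 \<le> inner x (M *v x)" unfolding q by (rule spec)
  qed
  moreover have "transpose M = M \<longleftrightarrow> (\<forall>i\<in>UNIV. \<forall>j\<in>UNIV. ?X i j = ?X j i)"
    by (simp add: transpose_def Finite_Cartesian_Product.vec_eq_iff) blast
  ultimately show ?thesis unfolding psd_matrix_def psd_on_def by blast
qed

lemma sdp_feasible_iff: "sdp_feasible M \<longleftrightarrow> correlation UNIV (\<lambda>i j. vec_nth (vec_nth M i) j)"
  by (simp add: sdp_feasible_def correlation_def psd_matrix_iff)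

text \<open>The objective of the program runs over ordered pairs and halves the result, so half of each
  edge weight goes into each of the two entries.\<close>

lemma low_rank_sdp_optimum:
  fixes G :: "('n::finite) sgraph"
  assumes "simple_graph G" "nodes G = UNIV" "low_rank_optima k G"
  shows "\<exists>X. sdp_optimal G w X \<and> rank X \<le> k"
proof -
  define A where "A i j = (if adj G i j then w {i, j} / 2 else 0)" for i j
  have obj: "sdp_objective G w X = pairing UNIV A (\<lambda>i j. vec_nth (vec_nth X i) j)" for X
  proof -
    have "pairing UNIV A (\<lambda>i j. vec_nth (vec_nth X i) j)
       = (\<Sum>p\<in>UNIV. if p \<in> {(i, j). adj G i j}
           then (case p of (i, j) \<Rightarrow> w {i, j} * vec_nth (vec_nth X i) j) / 2 else 0)"
      unfolding pairing_def sum.cartesian_product UNIV_Times_UNIV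
      by (intro sum.cong refl) (auto simp: A_def)
    also have "\<dots> = sdp_objective G w X"
      unfolding sdp_objective_def sum_divide_distrib
      by (intro sum.mono_neutral_cong_right) auto
    finally show ?thesis by simp
  qed
  have "weight_on G A"
    using adj_sym[of G] by (auto simp: weight_on_def A_def insert_commute)
  then obtain g where "gram_maximal k UNIV A g"
    using assms by (auto simp: low_rank_optima_def)
  then have "sdp_optimal G w (\<chi> i j. gram k g i j)"
    by (simp add: sdp_optimal_def sdp_feasible_iff obj gram_maximal_def)
  then show ?thesis using rank_gram_le by blast
qed

lemma minor_steps_delete_edges:
  assumes "finite D" "D \<subseteq> edges G"
  shows "minor_step\<^sup>*\<^sup>* G \<lparr>nodes = nodes G, edges = edges G - D\<rparr>"
  using assms
proof (induction D)
  case empty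
  show ?case by (cases G) simp
next
  case (insert e D)
  let ?H = "\<lparr>nodes = nodes G, edges = edges G - D\<rparr>"
  have "minor_step ?H (delete_edge e ?H)"
    using insert by (intro minor_step.edge_deletion) auto
  moreover have "delete_edge e ?H = \<lparr>nodes = nodes G, edges = edges G - insert e D\<rparr>"
    by (auto simp: delete_edge_def)
  ultimately show ?case using insert by (auto intro: rtranclp.rtrancl_into_rtrancl)
qed

text \<open>The product with a single node is a complete graph on as many nodes as \<open>G\<close>, from which the
  non-edges of \<open>G\<close> can be deleted. Hence the minimum in the definition of \<open>strong_largeur\<close> is taken over
  a nonempty set and is attained.\<close>

lemma minor_of_single_node_product:
  assumes G: "simple_graph G"
  defines "T \<equiv> \<lparr>nodes = {0 :: nat}, edges = {}\<rparr>"
  shows "graph_tree T" "graph_minor G (T \<boxtimes> complete_graph (card (nodes G)))"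
proof -
  have "\<not> graph_cycle T vs" for vs
  proof
    assume c: "graph_cycle T vs"
    then have "card (set vs) = length vs" "set vs \<subseteq> {0}"
      by (auto simp: graph_cycle_def T_def distinct_card)
    then have "length vs \<le> 1" using card_mono[of "{0}" "set vs"] by simp
    then show False using c by (simp add: graph_cycle_def)
  qed
  then show "graph_tree T"
    by (simp add: graph_tree_def simple_graph_def connected_graph_def T_def)
  let ?n = "card (nodes G)"
  let ?H = "T \<boxtimes> complete_graph ?n"
  have V: "finite (nodes G)" using G by (simp add: simple_graph_def)
  then obtain h where h: "bij_betw h (nodes G) {0..<?n}" using ex_bij_betw_finite_nat by blast
  define f where "f i = (0 :: nat, h i)" for i
  have f: "bij_betw f (nodes G) (nodes ?H)"
  proof -
    have "bij_betw (Pair 0) {0..<?n} ({0::nat} \<times> {..<?n})"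
      by (intro bij_betwI[of _ _ _ snd]) auto
    from bij_betw_trans[OF h this] show ?thesis
      by (simp add: f_def[abs_def] o_def nodes_product_complete T_def)
  qed
  define D where "D = edges ?H - (`) f ` edges G"
  have "simple_graph ?H"
    using \<open>graph_tree T\<close> by (intro simple_graph_strong_product simple_complete_graph) (simp add: graph_tree_def)
  then have "edges ?H \<subseteq> Pow (nodes ?H)" "finite (nodes ?H)" by (auto simp: simple_graph_def)
  then have "finite D" unfolding D_def using finite_subset by blast
  then have steps: "minor_step\<^sup>*\<^sup>* ?H \<lparr>nodes = nodes ?H, edges = edges ?H - D\<rparr>"
    by (rule minor_steps_delete_edges) (auto simp: D_def)
  have "{i, j} \<in> edges G \<longleftrightarrow> {f i, f j} \<in> edges ?H - D" if ij: "i \<in> nodes G" "j \<in> nodes G" for i j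
  proof
    assume e: "{i, j} \<in> edges G"
    then have "i \<noteq> j" using adj_nodes[OF G] by (auto simp: adj_def)
    then have "f i \<noteq> f j" using bij_betw_imp_inj_on[OF f] ij by (auto simp: inj_on_def)
    moreover have "f i \<in> nodes ?H" "f j \<in> nodes ?H" using f ij by (auto simp: bij_betw_def)
    ultimately have "adj ?H (f i) (f j)"
      by (auto simp: f_def adj_strong_product nodes_product_complete adj_complete_graph)
         (auto simp: complete_graph_def)
    moreover have "{f i, f j} \<in> (`) f ` edges G" using imageI[OF e, of "(`) f"] by simp
    ultimately show "{f i, f j} \<in> edges ?H - D" by (simp add: adj_def D_def)
  next
    assume "{f i, f j} \<in> edges ?H - D"
    then obtain e where e: "e \<in> edges G" "f ` {i, j} = f ` e" by (auto simp: D_def)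
    then have "e \<subseteq> nodes G" using G by (auto simp: simple_graph_def)
    then have "{i, j} = e"
      using inj_on_image_eq_iff[OF bij_betw_imp_inj_on[OF f], of "{i, j}" e] e(2) ij by simp
    then show "{i, j} \<in> edges G" using e by simp
  qed
  then have "graph_iso G \<lparr>nodes = nodes ?H, edges = edges ?H - D\<rparr>"
    unfolding graph_iso_def adj_def using f by (intro exI[of _ f]) simp
  with steps show "graph_minor G ?H" unfolding graph_minor_def by blast
qed

theorem corollary3p12:
  fixes G :: "('n::finite) sgraph"
  assumes "simple_graph G" and "nodes G = UNIV"
  shows "egd G \<le> strong_largeur G"
proof -
  let ?P = "\<lambda>k. 1 \<le> k \<and> (\<exists>T :: nat sgraph. graph_tree T \<and> graph_minor G (T \<boxtimes> complete_graph k))"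
  have "?P (card (nodes G))"
    using minor_of_single_node_product[OF assms(1)] assms(2) by (auto simp: Suc_le_eq)
  then have "?P (strong_largeur G)"
    unfolding strong_largeur_def by (rule LeastI)
  then obtain T :: "nat sgraph" where k: "1 \<le> strong_largeur G" and T: "graph_tree T"
    "graph_minor G (T \<boxtimes> complete_graph (strong_largeur G))" by blast
  have "low_rank_optima (strong_largeur G) G" by (rule low_rank_optima_minor[OF T])
  then show ?thesis
    unfolding egd_def using k low_rank_sdp_optimum[OF assms] by (intro Least_le) blast
qed

end
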